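(* Let $G=\mathbb{Z}^2\rtimes SL_2(\mathbb{Z})$. Then $G$ admits a Haagerup radical, and it is equal to $\mathbb{Z}^2\rtimes\mathbb{Z}/2\mathbb{Z}$, where $\mathbb{Z}/2\mathbb{Z}=\langle -I\rangle<SL_2(\mathbb{Z})$.
   Context: $SL_2(\mathbb{Z})$ acts on $\mathbb{Z}^2$ by matrix multiplication. A (discrete countable) group $G$ has the Haagerup property if there is a sequence of positive-definite functions in $c_0(G)$ converging pointwise to $1$. The Haagerup radical of a group $G$, if it exists, is the largest normal subgroup of $G$ with the Haagerup property, i.e. a normal Haagerup subgroup containing every normal Haagerup subgroup of $G$. *)

theory Defs
  imports "HOL-Analysis.Analysis" "HOL-Algebra.Elementary_Groups"
begin

section \<open>The Haagerup property and the Haagerup radical\<close>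

text \<open>In the sum below \<open>F\<close> ranges over the finite subsets of the group; families with repeated
  group elements add nothing, since their coefficients can be collected.\<close>

definition positive_definite :: "('a, 'm) monoid_scheme \<Rightarrow> ('a \<Rightarrow> complex) \<Rightarrow> bool" where
  "positive_definite G \<phi> \<longleftrightarrow>
     (\<forall>F (c :: 'a \<Rightarrow> complex). finite F \<and> F \<subseteq> carrier G \<longrightarrow>
        (\<Sum>g\<in>F. \<Sum>h\<in>F. cnj (c g) * c h * \<phi> (inv\<^bsub>G\<^esub> g \<otimes>\<^bsub>G\<^esub> h)) \<in> \<real>\<^sub>\<ge>\<^sub>0)"

definition vanishes_at_infinity :: "('a, 'm) monoid_scheme \<Rightarrow> ('a \<Rightarrow> complex) \<Rightarrow> bool" where
  "vanishes_at_infinity G \<phi> \<longleftrightarrow> (\<forall>\<epsilon>>0. finite {g \<in> carrier G. norm (\<phi> g) \<ge> \<epsilon>})"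

text \<open>The group is regarded as discrete.  Countability need not be demanded separately: it
  follows from the existence of such a sequence.\<close>

definition haagerup :: "('a, 'm) monoid_scheme \<Rightarrow> bool" where
  "haagerup G \<longleftrightarrow>
     (\<exists>\<phi> :: nat \<Rightarrow> 'a \<Rightarrow> complex.
        (\<forall>n. positive_definite G (\<phi> n) \<and> vanishes_at_infinity G (\<phi> n)) \<and>
        (\<forall>g\<in>carrier G. (\<lambda>n. \<phi> n g) \<longlonglongrightarrow> 1))"

definition is_haagerup_radical :: "('a, 'm) monoid_scheme \<Rightarrow> 'a set \<Rightarrow> bool" where
  "is_haagerup_radical G R \<longleftrightarrow>
     R \<lhd> G \<and> haagerup (G\<lparr>carrier := R\<rparr>) \<and>
     (\<forall>N. N \<lhd> G \<and> haagerup (G\<lparr>carrier := N\<rparr>) \<longrightarrow> N \<subseteq> R)"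

section \<open>Semidirect products, and the groups concerned\<close>

definition semidirect_product ::
  "('a, 'm) monoid_scheme \<Rightarrow> ('b, 'n) monoid_scheme \<Rightarrow> ('b \<Rightarrow> 'a \<Rightarrow> 'a) \<Rightarrow> ('a \<times> 'b) monoid" where
  "semidirect_product N H \<alpha> =
     \<lparr>carrier = carrier N \<times> carrier H,
      mult = (\<lambda>(m, g) (n, h). (m \<otimes>\<^bsub>N\<^esub> \<alpha> g n, g \<otimes>\<^bsub>H\<^esub> h)),
      one = (\<one>\<^bsub>N\<^esub>, \<one>\<^bsub>H\<^esub>)\<rparr>"

definition Z2 :: "(int ^ 2) monoid" where
  "Z2 = \<lparr>carrier = UNIV, mult = (+), one = 0\<rparr>"

definition SL2Z :: "(int ^ 2 ^ 2) monoid" where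
  "SL2Z = \<lparr>carrier = {A. det A = 1}, mult = (\<lambda>A B. A ** B), one = mat 1\<rparr>"

end

theory Submission
  imports Defs
begin

text \<open>The subgroup \<open>\<int>\<^sup>2 \<rtimes> {\<plusminus>I}\<close> is amenable, hence Haagerup. Conversely, a normal subgroup \<open>N\<close> with an
  element outside it contains \<open>k\<int>\<^sup>2\<close> for some \<open>k \<noteq> 0\<close> and two elements whose matrix parts are hyperbolic
  without common eigenlines. The argument is then that of Burger for relative property (T): the
  restriction to \<open>k\<int>\<^sup>2\<close> of a positive-definite function close to \<open>1\<close> corresponds to a measure on the dual torus
  that is concentrated near the origin and almost invariant under the two matrices. As these
  have no common invariant probability measure on the projective line, the measure must have an atom at the origin,
  which is impossible for a function in \<open>c\<^sub>0\<close>. Measures are avoided: the whole argument consists in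
  evaluating a positive-definite function on a single nonnegative trigonometric polynomial.\<close>

section \<open>Trigonometric polynomials and positive-definite functions on \<open>\<int>\<^sup>2\<close>\<close>

text \<open>The polynomial evaluated at the end is C((P o A^T - P) + (P' o A'^T - P')) + C' D + 4
  Psi - 1/2, with D the distance function \<open>dist_corner\<close>; it is nonnegative on the
  torus. At the restriction of phi_j the first term is at most about 1/4 by almost invariance, the
  D-term tends to 0 by convergence to 1, the Psi-term is below 1/8 by the c0 condition, and the
  constant contributes about -1/2. The obstacle is a circular dependence: Psi depends on phi_j, and
  P, P' depend on Psi, because the direction of a point is discontinuous at the origin and has to be
  regularised on the scale on which Psi stays large. So nothing is known about the degree of P when
  j is chosen. Hence C and C' are fixed before Psi, and the almost-invariance estimate involves P
  only through a bound for its supremum.\<close>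

definition char2 :: "real \<times> real \<Rightarrow> int \<times> int \<Rightarrow> complex" where
  "char2 x n = cis (of_int (fst n) * fst x + of_int (snd n) * snd x)"

definition pd_fun :: "('a::ab_group_add \<Rightarrow> complex) \<Rightarrow> bool" where
  "pd_fun \<psi> \<longleftrightarrow>
     (\<forall>F c. finite F \<longrightarrow> (\<Sum>g\<in>F. \<Sum>h\<in>F. cnj (c g) * c h * \<psi> (h - g)) \<in> \<real>\<^sub>\<ge>\<^sub>0)"

text \<open>A trigonometric polynomial on the torus is encoded by the functional it induces on functions on
  the dual group; its value at \<open>x\<close> is recovered as \<open>\<Phi> (char2 x)\<close>.\<close>

inductive trig_poly :: "((int \<times> int \<Rightarrow> complex) \<Rightarrow> real) \<Rightarrow> bool" where
  monomial: "trig_poly (\<lambda>\<psi>. Re (c * \<psi> n))"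
| add: "trig_poly \<Phi> \<Longrightarrow> trig_poly \<Psi> \<Longrightarrow> trig_poly (\<lambda>\<psi>. \<Phi> \<psi> + \<Psi> \<psi>)"

lemma trig_poly_scale:
  assumes "trig_poly \<Phi>" shows "trig_poly (\<lambda>\<psi>. a * \<Phi> \<psi>)"
  using assms
proof induction
  case (monomial c n)
  show ?case using trig_poly.monomial[of "of_real a * c" n] by (simp add: mult.assoc)
next
  case (add \<Phi> \<Psi>)
  show ?case using trig_poly.add[OF add.IH] by (simp add: distrib_left)
qed

lemma trig_poly_diff: "trig_poly \<Phi> \<Longrightarrow> trig_poly \<Psi> \<Longrightarrow> trig_poly (\<lambda>\<psi>. \<Phi> \<psi> - \<Psi> \<psi>)"
  using trig_poly.add[OF _ trig_poly_scale[of \<Psi> "-1"]] by simp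

lemma trig_poly_Re: "trig_poly (\<lambda>\<psi>. Re (\<psi> n))"
  using trig_poly.monomial[of 1 n] by simp

lemma trig_poly_zero: "trig_poly (\<lambda>\<psi>. 0)"
  using trig_poly.monomial[of 0 0] by simp

lemma trig_poly_sum: "finite I \<Longrightarrow> (\<And>i. i \<in> I \<Longrightarrow> trig_poly (\<Phi> i)) \<Longrightarrow> trig_poly (\<lambda>\<psi>. \<Sum>i\<in>I. \<Phi> i \<psi>)"
  by (induction I rule: finite_induct) (auto intro: trig_poly_zero trig_poly.add)

text \<open>For \<open>f\<close> an integer matrix this is substitution of the transpose on the
  torus (\<open>char2_lin\<close>), so composing with the dual action stays among trigonometric
  polynomials.\<close>

lemma trig_poly_pullback:
  assumes "trig_poly \<Phi>" shows "trig_poly (\<lambda>\<psi>. \<Phi> (\<lambda>n. \<psi> (f n)))"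
  using assms by induction (rule trig_poly.intros; assumption?)+

lemma trig_poly_linear:
  assumes "trig_poly \<Phi>"
  shows "\<Phi> (\<lambda>n. of_real a * \<psi> n + \<zeta> n) = a * \<Phi> \<psi> + \<Phi> \<zeta>"
  using assms by induction (auto simp: algebra_simps)

lemma trig_poly_of_zero: "trig_poly \<Phi> \<Longrightarrow> \<Phi> (\<lambda>n. 0) = 0"
  by (induction rule: trig_poly.induct) auto

lemma trig_poly_linear_sum:
  assumes "trig_poly \<Phi>" "finite X"
  shows "\<Phi> (\<lambda>n. \<Sum>x\<in>X. of_real (r x) * \<psi> x n) = (\<Sum>x\<in>X. r x * \<Phi> (\<psi> x))"
  using assms(2)
  by (induction X rule: finite_induct)
     (simp_all add: trig_poly_linear[OF assms(1)] trig_poly_of_zero[OF assms(1)])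

lemma trig_poly_tendsto:
  assumes "trig_poly \<Phi>" "\<And>n. (\<lambda>M::nat. \<kappa> M n) \<longlonglongrightarrow> \<psi> n"
  shows "(\<lambda>M. \<Phi> (\<kappa> M)) \<longlonglongrightarrow> \<Phi> \<psi>"
  using assms by induction (auto intro!: tendsto_intros)

lemma char2_add: "char2 x (n + m) = char2 x n * char2 x m"
  by (simp add: char2_def cis_mult algebra_simps)

lemma char2_uminus: "char2 x (- n) = cnj (char2 x n)"
  by (simp add: char2_def cis_cnj algebra_simps)

lemma char2_diff: "char2 x (n - m) = char2 x n * cnj (char2 x m)"
  using char2_add[of x n "- m"] by (simp add: char2_uminus)

lemma char2_zero [simp]: "char2 x 0 = 1" "char2 (0, 0) n = 1"
  by (simp_all add: char2_def)

text \<open>Orthogonality of characters of a cyclic group: the summands are powers of a Q-th root of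
  unity z, and z = 1 exactly when Q divides m; otherwise the geometric sum vanishes.\<close>

lemma sum_cis_roots:
  fixes m :: int
  assumes "Q > 0"
  shows "(\<Sum>k<Q. cis (of_int m * (2 * pi * real k / real Q))) = (if int Q dvd m then of_nat Q else 0)"
proof -
  define z where "z = cis (of_int m * (2 * pi / real Q))"
  have p: "cis (of_int m * (2 * pi * real k / real Q)) = z ^ k" for k
    unfolding z_def Complex.DeMoivre by (simp add: field_simps)
  have zQ: "z ^ Q = 1"
    unfolding z_def Complex.DeMoivre using assms cis_multiple_2pi[of "of_int m"]
    by (simp add: mult.commute)
  show ?thesis
  proof (cases "int Q dvd m")
    case True
    then obtain l where l: "m = int Q * l" by auto
    have "z = cis (2 * pi * of_int l)" unfolding z_def l using assms by (simp add: field_simps)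
    then have "z = 1" using cis_multiple_2pi[of "of_int l"] by simp
    then show ?thesis using True unfolding p by simp
  next
    case False
    have "z \<noteq> 1"
    proof
      assume "z = 1"
      then have "cos (of_int m * (2 * pi / real Q)) = 1" by (metis z_def cis.sel(1) one_complex.sel(1))
      then obtain l :: int where "of_int m * (2 * pi / real Q) = of_int l * 2 * pi"
        by (auto simp: cos_one_2pi_int)
      then have "real_of_int m = of_int l * real Q" using assms by (simp add: field_simps)
      then have "m = l * int Q" by (metis of_int_eq_iff of_int_mult of_int_of_nat_eq)
      then show False using False by simp
    qed
    then show ?thesis using False unfolding p by (simp add: sum_gp_strict zQ)
  qed
qed

section \<open>Fejer weights as counts of pairs with a given difference\<close>

lemma dvd_bounded_imp_zero: "int Q dvd d \<Longrightarrow> \<bar>d\<bar> < int Q \<Longrightarrow> d = 0"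
  using zdvd_imp_le[of "int Q" "\<bar>d\<bar>"] by (cases "d = 0") auto

lemma card_shifted_pairs:
  "card {(i, j). i \<in> {0..<int M} \<and> j \<in> {0..<int M} \<and> j - i = d} = nat (int M - \<bar>d\<bar>)"
proof -
  have "{(i, j). i \<in> {0..<int M} \<and> j \<in> {0..<int M} \<and> j - i = d}
      = (\<lambda>i. (i, i + d)) ` {max 0 (- d)..<min (int M) (int M - d)}"
    by (auto simp: image_iff)
  moreover have "inj_on (\<lambda>i. (i, i + d)) X" for X by (auto simp: inj_on_def)
  ultimately have "card {(i, j). i \<in> {0..<int M} \<and> j \<in> {0..<int M} \<and> j - i = d}
      = nat (min (int M) (int M - d) - max 0 (- d))"
    by (simp add: card_image)
  also have "min (int M) (int M - d) - max 0 (- d) = int M - \<bar>d\<bar>" by (auto simp: min_def max_def abs_if)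
  finally show ?thesis .
qed

text \<open>Regrouping coordinates reduces this to two one-dimensional counts. It is used twice: as
  an unnormalised Fejer coefficient, and as the overlap of a box in Z^2 with a translate of
  it.\<close>

lemma card_shifted_pairs2:
  fixes n :: "int \<times> int" and M :: nat
  defines "B \<equiv> {0..<int M} \<times> {0..<int M}"
  shows "card {(g, h). g \<in> B \<and> h \<in> B \<and> h - g = n}
       = nat (int M - \<bar>fst n\<bar>) * nat (int M - \<bar>snd n\<bar>)"
proof -
  let ?P = "\<lambda>d. {(i, j). i \<in> {0..<int M} \<and> j \<in> {0..<int M} \<and> j - i = d}"
  have "{(g, h). g \<in> B \<and> h \<in> B \<and> h - g = n}
      = (\<lambda>((i, j), (k, l)). ((i, k), (j, l))) ` (?P (fst n) \<times> ?P (snd n))"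
    unfolding B_def by (cases n) (force simp: image_iff)
  moreover have "inj_on (\<lambda>((i, j), (k, l)). ((i, k), (j, l))) X" for X :: "((int \<times> int) \<times> int \<times> int) set"
    by (auto simp: inj_on_def)
  ultimately have "card {(g, h). g \<in> B \<and> h \<in> B \<and> h - g = n} = card (?P (fst n)) * card (?P (snd n))"
    by (simp add: card_image card_cartesian_product)
  then show ?thesis by (simp only: card_shifted_pairs)
qed

lemma tendsto_fejer_factor: "(\<lambda>M. real (nat (int M - \<bar>d\<bar>)) / real M) \<longlonglongrightarrow> 1"
proof -
  have "(\<lambda>M. 1 - \<bar>real_of_int d\<bar> * (1 / real M)) \<longlonglongrightarrow> 1 - \<bar>real_of_int d\<bar> * 0"
    by (intro tendsto_intros lim_1_over_n)
  moreover have "\<forall>\<^sub>F M in sequentially. 1 - \<bar>real_of_int d\<bar> * (1 / real M) = real (nat (int M - \<bar>d\<bar>)) / real M"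
    using eventually_ge_at_top[of "Suc (nat \<bar>d\<bar>)"]
  proof eventually_elim
    case (elim M)
    then have "real (nat (int M - \<bar>d\<bar>)) = real M - \<bar>real_of_int d\<bar>" "real M > 0" by (auto simp: of_nat_nat)
    then show ?case by (simp add: field_simps)
  qed
  ultimately show ?thesis by (simp add: tendsto_cong)
qed

text \<open>Fejer summation, with the integral over the torus replaced by the average over a grid that is
  fine enough for the orthogonality relations in play to be exact.\<close>

lemma pd_fun_fejer_approx:
  fixes \<psi> :: "int \<times> int \<Rightarrow> complex"
  assumes "pd_fun \<psi>"
  obtains X :: "nat \<Rightarrow> (nat \<times> nat) set" and r y where
    "\<And>M. finite (X M)" "\<And>M i. r M i \<ge> (0::real)"
    "\<And>n. (\<lambda>M. \<Sum>i\<in>X M. of_real (r M i) * char2 (y M i) n) \<longlonglongrightarrow> \<psi> n"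
proof -
  \<comment> \<open>With 2M points per direction there is no aliasing: for g, h in the box of side M
    and coordinates of n bounded by M, the frequency n - (h - g) has coordinates of absolute value
    below 2M.\<close>
  define X where "X M = {..<2 * M} \<times> {..<2 * M}" for M :: nat
  define y where "y M = (\<lambda>(k, l). (2 * pi * real k / real (2 * M), 2 * pi * real l / real (2 * M)))" for M :: nat
  define B where "B M = {0..<int M} \<times> {0..<int M}" for M
  \<comment> \<open>The quadratic form of positive definiteness with conjugated characters as
    coefficients: up to the factor M^2 this is the Fejer mean of the Fourier series of
    \<open>\<psi>\<close>, and it is nonnegative at every grid point.\<close>
  define s where "s M i = (\<Sum>g\<in>B M. \<Sum>h\<in>B M. cnj (cnj (char2 (y M i) g)) * cnj (char2 (y M i) h) * \<psi> (h - g))" for M i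
  have sR: "s M i \<in> \<real>\<^sub>\<ge>\<^sub>0" for M i
    unfolding s_def
    by (rule assms[unfolded pd_fun_def, rule_format, of "B M" "\<lambda>g. cnj (char2 (y M i) g)"])
      (simp add: B_def)
  have sRe: "of_real (Re (s M i)) = s M i" and sRe0: "Re (s M i) \<ge> 0" for M i
    using sR[of M i] by (auto simp: nonneg_Reals_def)
  \<comment> \<open>The first factor is the number of grid points, coming from orthogonality; the
    second is the number of points of the box.\<close>
  define N where "N M = real ((2 * M) ^ 2) * real (M ^ 2)" for M
  define r where "r M i = Re (s M i) / N M" for M i
  have char_sum: "(\<Sum>i\<in>X M. char2 (y M i) d) = (if d = 0 then of_nat ((2 * M) ^ 2) else 0)"
    if M: "M > 0" and d: "\<bar>fst d\<bar> < 2 * int M" "\<bar>snd d\<bar> < 2 * int M" for M d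
  proof -
    have *: "(if int (2 * M) dvd e then of_nat (2 * M) else (0::complex)) = (if e = 0 then of_nat (2 * M) else 0)"
      if "\<bar>e\<bar> < 2 * int M" for e
      using dvd_bounded_imp_zero[of "2 * M" e] that by auto
    have "(\<Sum>i\<in>X M. char2 (y M i) d) =
        (\<Sum>k<2*M. cis (of_int (fst d) * (2 * pi * real k / real (2 * M)))) *
        (\<Sum>l<2*M. cis (of_int (snd d) * (2 * pi * real l / real (2 * M))))"
      unfolding X_def sum_product sum.cartesian_product
      by (intro sum.cong refl) (auto simp: char2_def y_def cis_mult)
    also have "\<dots> = (if fst d = 0 then of_nat (2 * M) else 0) * (if snd d = 0 then of_nat (2 * M) else 0)"
      using M d by (simp only: sum_cis_roots * zero_less_mult_iff zero_less_numeral simp_thms if_True)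
    also have "\<dots> = (if d = 0 then of_nat ((2 * M) ^ 2) else 0)"
      by (cases d) (auto simp: power2_eq_square zero_prod_def)
    finally show ?thesis .
  qed
  have key: "(\<Sum>i\<in>X M. of_real (r M i) * char2 (y M i) n)
      = of_real (real (nat (int M - \<bar>fst n\<bar>)) / real M * (real (nat (int M - \<bar>snd n\<bar>)) / real M)) * \<psi> n"
    if M: "M > 0" and n: "\<bar>fst n\<bar> \<le> int M" "\<bar>snd n\<bar> \<le> int M" for M n
  proof -
    have "(\<Sum>i\<in>X M. of_real (r M i) * char2 (y M i) n) = (\<Sum>i\<in>X M. s M i * char2 (y M i) n) / N M"
      by (simp add: r_def sRe sum_divide_distrib)
    also have "(\<Sum>i\<in>X M. s M i * char2 (y M i) n)
        = (\<Sum>i\<in>X M. \<Sum>g\<in>B M. \<Sum>h\<in>B M. \<psi> (h - g) * char2 (y M i) (n - (h - g)))"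
      unfolding s_def sum_distrib_right
      by (intro sum.cong refl) (simp add: char2_diff mult_ac)
    also have "\<dots> = (\<Sum>g\<in>B M. \<Sum>h\<in>B M. \<Sum>i\<in>X M. \<psi> (h - g) * char2 (y M i) (n - (h - g)))"
      by (subst sum.swap, intro sum.cong refl, subst sum.swap, rule refl)
    also have "\<dots> = (\<Sum>g\<in>B M. \<Sum>h\<in>B M. \<psi> (h - g) * (if n - (h - g) = 0 then of_nat ((2 * M) ^ 2) else 0))"
      unfolding sum_distrib_left[symmetric]
    proof (intro sum.cong refl)
      fix g h assume "g \<in> B M" "h \<in> B M"
      then show "\<psi> (h - g) * (\<Sum>i\<in>X M. char2 (y M i) (n - (h - g)))
        = \<psi> (h - g) * (if n - (h - g) = 0 then of_nat ((2 * M) ^ 2) else 0)"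
        using n by (subst char_sum[OF M]) (auto simp: B_def)
    qed
    also have "\<dots> = (\<Sum>g\<in>B M. \<Sum>h\<in>B M. if h - g = n then \<psi> n * of_nat ((2 * M) ^ 2) else 0)"
      by (intro sum.cong refl) auto
    also have "\<dots> = (\<Sum>p\<in>B M \<times> B M. if snd p - fst p = n then \<psi> n * of_nat ((2 * M) ^ 2) else 0)"
      by (simp add: sum.cartesian_product case_prod_beta)
    also have "\<dots> = (\<Sum>p\<in>{p \<in> B M \<times> B M. snd p - fst p = n}. \<psi> n * of_nat ((2 * M) ^ 2))"
      by (rule sum.inter_filter[symmetric]) (simp add: B_def)
    also have "\<dots> = of_nat (card {p \<in> B M \<times> B M. snd p - fst p = n}) * (\<psi> n * of_nat ((2 * M) ^ 2))"
      by simp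
    also have "{p \<in> B M \<times> B M. snd p - fst p = n} = {(g, h). g \<in> B M \<and> h \<in> B M \<and> h - g = n}"
      by auto
    also have "card \<dots> = nat (int M - \<bar>fst n\<bar>) * nat (int M - \<bar>snd n\<bar>)"
      unfolding B_def by (rule card_shifted_pairs2)
    finally show ?thesis using M by (simp add: N_def field_simps power2_eq_square)
  qed
  have "(\<lambda>M. \<Sum>i\<in>X M. of_real (r M i) * char2 (y M i) n) \<longlonglongrightarrow> \<psi> n" for n
  proof -
    have "(\<lambda>M. of_real (real (nat (int M - \<bar>fst n\<bar>)) / real M * (real (nat (int M - \<bar>snd n\<bar>)) / real M)) * \<psi> n)
        \<longlonglongrightarrow> of_real (1 * 1) * \<psi> n"
      by (intro tendsto_intros tendsto_fejer_factor)
    moreover have "\<forall>\<^sub>F M in sequentially.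
        of_real (real (nat (int M - \<bar>fst n\<bar>)) / real M * (real (nat (int M - \<bar>snd n\<bar>)) / real M)) * \<psi> n
        = (\<Sum>i\<in>X M. of_real (r M i) * char2 (y M i) n)"
      using eventually_ge_at_top[of "nat (\<bar>fst n\<bar> + \<bar>snd n\<bar> + 1)"]
    proof eventually_elim
      case (elim M)
      then show ?case by (intro key[symmetric]) linarith+
    qed
    ultimately show ?thesis using tendsto_cong by fastforce
  qed
  moreover have "finite (X M)" for M by (simp add: X_def)
  moreover have "r M i \<ge> 0" for M i by (simp add: r_def N_def sRe0)
  ultimately show thesis using that by blast
qed

text \<open>Takes the place of Bochner's theorem: \<open>\<psi>\<close> is a pointwise limit of
  nonnegative combinations of characters, and \<open>\<Phi>\<close> involves only finitely many
  values of its argument.\<close>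

lemma trig_poly_nonneg:
  assumes "trig_poly \<Phi>" "pd_fun \<psi>" "\<And>x. \<Phi> (char2 x) \<ge> 0"
  shows "\<Phi> \<psi> \<ge> 0"
proof -
  obtain X :: "nat \<Rightarrow> (nat \<times> nat) set" and r y where
    X: "\<And>M. finite (X M)" "\<And>M i. r M i \<ge> (0::real)"
    "\<And>n. (\<lambda>M. \<Sum>i\<in>X M. of_real (r M i) * char2 (y M i) n) \<longlonglongrightarrow> \<psi> n"
    by (rule pd_fun_fejer_approx[OF assms(2)]) (rule that)
  have "(\<lambda>M. \<Phi> (\<lambda>n. \<Sum>i\<in>X M. of_real (r M i) * char2 (y M i) n)) \<longlonglongrightarrow> \<Phi> \<psi>"
    by (rule trig_poly_tendsto[OF assms(1) X(3)])
  moreover have "\<Phi> (\<lambda>n. \<Sum>i\<in>X M. of_real (r M i) * char2 (y M i) n) \<ge> 0" for M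
    unfolding trig_poly_linear_sum[OF assms(1) X(1)]
    by (intro sum_nonneg mult_nonneg_nonneg X(2) assms(3))
  ultimately show ?thesis by (meson LIMSEQ_le_const)
qed

section \<open>Test polynomials for pairs of hyperbolic matrices\<close>

text \<open>Re z Re w = Re (z w) / 2 + Re (z cnj w) / 2. Only values at characters are asserted,
  since the induced functionals are not multiplicative on other functions.\<close>

lemma trig_poly_mult:
  assumes "trig_poly \<Phi>" "trig_poly \<Psi>"
  shows "\<exists>\<Omega>. trig_poly \<Omega> \<and> (\<forall>x. \<Omega> (char2 x) = \<Phi> (char2 x) * \<Psi> (char2 x))"
  using assms(1)
proof induction
  case (monomial c n)
  show ?case
    using assms(2)
  proof induction
    case (monomial d m)
    have "Re (c * d / 2 * char2 x (n + m)) + Re (c * cnj d / 2 * char2 x (n - m))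
        = Re (c * char2 x n) * Re (d * char2 x m)" for x
      by (simp add: char2_add char2_diff field_simps)
    moreover have "trig_poly (\<lambda>\<psi>. Re (c * d / 2 * \<psi> (n + m)) + Re (c * cnj d / 2 * \<psi> (n - m)))"
      by (intro trig_poly.intros)
    ultimately show ?case by blast
  next
    case (add \<Phi> \<Psi>)
    then obtain \<Omega> \<Omega>' where "trig_poly \<Omega>" "trig_poly \<Omega>'"
      "\<forall>x. \<Omega> (char2 x) = Re (c * char2 x n) * \<Phi> (char2 x)"
      "\<forall>x. \<Omega>' (char2 x) = Re (c * char2 x n) * \<Psi> (char2 x)" by blast
    then show ?case
      by (intro exI[of _ "\<lambda>\<psi>. \<Omega> \<psi> + \<Omega>' \<psi>"]) (auto intro: trig_poly.add simp: distrib_left)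
  qed
next
  case (add \<Phi> \<Phi>')
  then obtain \<Omega> \<Omega>' where "trig_poly \<Omega>" "trig_poly \<Omega>'"
    "\<forall>x. \<Omega> (char2 x) = \<Phi> (char2 x) * \<Psi> (char2 x)"
    "\<forall>x. \<Omega>' (char2 x) = \<Phi>' (char2 x) * \<Psi> (char2 x)" by blast
  then show ?case
    by (intro exI[of _ "\<lambda>\<psi>. \<Omega> \<psi> + \<Omega>' \<psi>"]) (auto intro: trig_poly.add simp: distrib_right)
qed

lemma trig_poly_continuous:
  assumes "trig_poly \<Phi>" shows "continuous_on A (\<lambda>x. \<Phi> (char2 x))"
  using assms
proof induction
  case (monomial c n)
  show ?case unfolding char2_def by (intro continuous_intros)
next
  case (add \<Phi> \<Psi>)
  then show ?case by (intro continuous_intros)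
qed

section \<open>Uniform approximation on the torus\<close>

abbreviation torus :: "(complex \<times> complex) set" where
  "torus \<equiv> sphere 0 1 \<times> sphere 0 1"

abbreviation cis2 :: "real \<times> real \<Rightarrow> complex \<times> complex" where
  "cis2 x \<equiv> (cis (fst x), cis (snd x))"

text \<open>Stone-Weierstrass. The torus is taken inside C^2, so that it is compact and periodicity
  is automatic; \<open>R\<close> is an algebra by \<open>trig_poly_mult\<close> and is separating by
  its monomials of degree one.\<close>

lemma trig_poly_dense:
  fixes F :: "complex \<times> complex \<Rightarrow> real"
  assumes "continuous_on torus F" "e > 0"
  shows "\<exists>\<Phi>. trig_poly \<Phi> \<and> (\<forall>x. \<bar>F (cis2 x) - \<Phi> (char2 x)\<bar> < e)"
proof -
  define R where "R = {f. continuous_on torus f \<and>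
    (\<exists>\<Phi>. trig_poly \<Phi> \<and> (\<forall>x. f (cis2 x) = \<Phi> (char2 x)))}"
  \<comment> \<open>Coefficients 1 and -i produce the real and imaginary parts of a coordinate,
    which separate points.\<close>
  have coord: "(\<lambda>p. Re (c * fst p + d * snd p)) \<in> R" for c d
  proof -
    have "trig_poly (\<lambda>\<psi>. Re (c * \<psi> (1, 0)) + Re (d * \<psi> (0, 1)))" by (intro trig_poly.intros)
    moreover have "continuous_on torus (\<lambda>p. Re (c * fst p + d * snd p))" by (intro continuous_intros)
    ultimately show ?thesis unfolding R_def
      by (auto simp: char2_def intro!: exI[of _ "\<lambda>\<psi>. Re (c * \<psi> (1, 0)) + Re (d * \<psi> (0, 1))"])
  qed
  interpret function_ring_on R torus
  proof
    show "compact torus" by (intro compact_Times compact_sphere)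
    fix f assume f: "f \<in> R"
    then show "continuous_on torus f" by (simp add: R_def)
    fix g assume g: "g \<in> R"
    obtain \<Phi> \<Psi> where p: "trig_poly \<Phi>" "trig_poly \<Psi>" "\<forall>x. f (cis2 x) = \<Phi> (char2 x)"
       "\<forall>x. g (cis2 x) = \<Psi> (char2 x)"
      using f g unfolding R_def by blast
    show "(\<lambda>x. f x + g x) \<in> R"
      using f g p unfolding R_def
      by (auto intro!: continuous_intros exI[of _ "\<lambda>\<psi>. \<Phi> \<psi> + \<Psi> \<psi>"] trig_poly.add)
    obtain \<Omega> where "trig_poly \<Omega>" "\<forall>x. \<Omega> (char2 x) = \<Phi> (char2 x) * \<Psi> (char2 x)"
      using trig_poly_mult[OF p(1,2)] by blast
    then show "(\<lambda>x. f x * g x) \<in> R"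
      using f g p unfolding R_def by (auto intro!: continuous_intros exI[of _ \<Omega>])
  next
    fix c :: real
    have "trig_poly (\<lambda>\<psi>. Re (of_real c * \<psi> 0))" by (rule trig_poly.monomial)
    then show "(\<lambda>_. c) \<in> R" unfolding R_def
      by (auto intro!: exI[of _ "\<lambda>\<psi>. Re (of_real c * \<psi> 0)"])
  next
    fix p q :: "complex \<times> complex" assume "p \<noteq> q"
    then consider "Re (fst p) \<noteq> Re (fst q)" | "Im (fst p) \<noteq> Im (fst q)"
      | "Re (snd p) \<noteq> Re (snd q)" | "Im (snd p) \<noteq> Im (snd q)"
      by (auto simp: prod_eq_iff complex_eq_iff)
    then show "\<exists>f\<in>R. f p \<noteq> f q"
    proof cases
      case 1 then show ?thesis using coord[of 1 0] by (auto intro: bexI[rotated])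
    next
      case 2 then show ?thesis using coord[of "- \<i>" 0] by (auto intro: bexI[rotated])
    next
      case 3 then show ?thesis using coord[of 0 1] by (auto intro: bexI[rotated])
    next
      case 4 then show ?thesis using coord[of 0 "- \<i>"] by (auto intro: bexI[rotated])
    qed
  qed
  obtain g where g: "g \<in> R" "\<forall>p\<in>torus. \<bar>F p - g p\<bar> < e"
    using Stone_Weierstrass_basic[OF assms] by blast
  obtain \<Phi> where \<Phi>: "trig_poly \<Phi>" "\<forall>x. g (cis2 x) = \<Phi> (char2 x)"
    using g(1) unfolding R_def by blast
  have "\<bar>F (cis2 x) - \<Phi> (char2 x)\<bar> < e" for x
    using g(2)[rule_format, of "cis2 x"] \<Phi>(2) by simp
  with \<Phi>(1) show ?thesis by blast
qed

text \<open>The squared cosine of a direction, made continuous at the origin by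
  \<open>\<eta>\<close>. In use, s and t are the eigencoordinates of a hyperbolic matrix, which maps
  them to l s and t / l.\<close>

definition dirratio :: "real \<Rightarrow> real \<Rightarrow> real \<Rightarrow> real" where
  "dirratio \<eta> s t = s\<^sup>2 / (s\<^sup>2 + t\<^sup>2 + \<eta>)"

lemma dirratio_bounds: "\<eta> > 0 \<Longrightarrow> 0 \<le> dirratio \<eta> s t \<and> dirratio \<eta> s t \<le> 1"
  by (auto simp: dirratio_def divide_simps add_pos_nonneg add_nonneg_pos)

text \<open>Over the common denominator the numerator is (l^2 - 1/l^2) (s t)^2 + eta s^2 (l^2 - 1);
  the second summand is nonnegative and is dropped.\<close>

lemma dirratio_increase:
  assumes "\<eta> > 0" "l > 1"
  shows "dirratio \<eta> (l * s) (t / l) - dirratio \<eta> s t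
    \<ge> (l\<^sup>2 - 1 / l\<^sup>2) * (s * t)\<^sup>2 / (((l * s)\<^sup>2 + (t / l)\<^sup>2 + \<eta>) * (s\<^sup>2 + t\<^sup>2 + \<eta>))"
    (is "_ \<ge> _ / (?P * ?Q)")
proof -
  have P: "?P > 0" and Q: "?Q > 0" using assms(1) by (simp_all add: add_nonneg_pos)
  have "dirratio \<eta> (l * s) (t / l) - dirratio \<eta> s t = ((l * s)\<^sup>2 * ?Q - s\<^sup>2 * ?P) / (?P * ?Q)"
    unfolding dirratio_def using P Q by (simp add: diff_frac_eq mult.commute)
  also have "(l * s)\<^sup>2 * ?Q - s\<^sup>2 * ?P = (l\<^sup>2 - 1 / l\<^sup>2) * (s * t)\<^sup>2 + \<eta> * s\<^sup>2 * (l\<^sup>2 - 1)"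
    using assms(2) by (simp add: field_simps power2_eq_square)
  finally have "dirratio \<eta> (l * s) (t / l) - dirratio \<eta> s t
    = ((l\<^sup>2 - 1 / l\<^sup>2) * (s * t)\<^sup>2 + \<eta> * s\<^sup>2 * (l\<^sup>2 - 1)) / (?P * ?Q)" .
  moreover have "\<eta> * s\<^sup>2 * (l\<^sup>2 - 1) \<ge> 0" using assms by simp
  ultimately show ?thesis using P Q by (simp add: divide_right_mono)
qed

text \<open>In use, R = y . y. The assumption \<open>\<eta> \<le> R\<close> bounds both denominators
  by a multiple of R, so the gain depends only on the direction of y and no longer on
  \<open>\<eta>\<close>.\<close>

lemma dirratio_increase_quantitative:
  assumes "\<eta> > 0" "l > 1" "\<eta> \<le> R" "s\<^sup>2 \<le> k * R" "t\<^sup>2 \<le> k * R"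
  shows "dirratio \<eta> (l * s) (t / l) - dirratio \<eta> s t
    \<ge> (l\<^sup>2 - 1 / l\<^sup>2) / (2 * l\<^sup>2 * k + 1)\<^sup>2 * ((s * t)\<^sup>2 / R\<^sup>2)"
proof -
  let ?P = "(l * s)\<^sup>2 + (t / l)\<^sup>2 + \<eta>" and ?Q = "s\<^sup>2 + t\<^sup>2 + \<eta>" and ?K = "2 * l\<^sup>2 * k + 1"
  have l2: "l\<^sup>2 \<ge> 1" using assms(2) by simp
  have R: "R > 0" using assms by simp
  have t0: "t\<^sup>2 \<le> l\<^sup>2 * t\<^sup>2" and s0: "s\<^sup>2 \<le> l\<^sup>2 * s\<^sup>2"
    using mult_right_mono[OF l2, of "t\<^sup>2"] mult_right_mono[OF l2, of "s\<^sup>2"] by auto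
  have "(t / l)\<^sup>2 \<le> t\<^sup>2"
    using l2 by (simp add: power_divide divide_simps) (metis mult_left_mono mult.right_neutral zero_le_power2)
  with t0 have tl: "(t / l)\<^sup>2 \<le> l\<^sup>2 * t\<^sup>2" by linarith
  have ls: "(l * s)\<^sup>2 = l\<^sup>2 * s\<^sup>2" by (simp add: power_mult_distrib)
  have sR: "l\<^sup>2 * s\<^sup>2 \<le> l\<^sup>2 * (k * R)" and tR: "l\<^sup>2 * t\<^sup>2 \<le> l\<^sup>2 * (k * R)"
    using assms(4,5) by (auto intro: mult_left_mono)
  have KR: "?K * R = l\<^sup>2 * (k * R) + l\<^sup>2 * (k * R) + R" by (simp add: algebra_simps)
  have P: "?P \<le> ?K * R" "?P > 0" and Q: "?Q \<le> ?K * R" "?Q > 0"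
    using sR tR tl s0 t0 assms(1,3) unfolding KR ls by (linarith, simp add: add_nonneg_pos, linarith, simp add: add_nonneg_pos)
  have "?P * ?Q \<le> (?K * R) * (?K * R)" using P Q by (intro mult_mono) auto
  moreover have "(l\<^sup>2 - 1 / l\<^sup>2) * (s * t)\<^sup>2 \<ge> 0"
  proof -
    have "1 / l\<^sup>2 \<le> 1" using l2 assms(2) by (simp add: divide_simps)
    with l2 show ?thesis by simp
  qed
  ultimately have "(l\<^sup>2 - 1 / l\<^sup>2) * (s * t)\<^sup>2 / ((?K * R) * (?K * R)) \<le> (l\<^sup>2 - 1 / l\<^sup>2) * (s * t)\<^sup>2 / (?P * ?Q)"
    using P Q by (intro divide_left_mono) auto
  also have "\<dots> \<le> dirratio \<eta> (l * s) (t / l) - dirratio \<eta> s t" by (rule dirratio_increase[OF assms(1,2)])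
  finally show ?thesis by (simp add: power2_eq_square mult_ac)
qed

text \<open>Measures closeness to the trivial character by a function that is itself a trigonometric
  polynomial: at \<open>\<psi>\<close> it becomes 2 Re psi(0) - Re psi(1,0) - Re psi(0,1), which
  convergence to 1 makes small.\<close>

definition dist_corner :: "complex \<times> complex \<Rightarrow> real" where
  "dist_corner p = 2 - Re (fst p) - Re (snd p)"

text \<open>Equal to 1 where \<open>dist_corner\<close> is at most 1/4 and to 0 where it is at least
  1/2.\<close>

definition cutoff :: "complex \<times> complex \<Rightarrow> real" where
  "cutoff p = max 0 (min 1 (2 - 4 * dist_corner p))"

text \<open>Two closed pieces are glued: for \<open>dist_corner\<close> at most 1/2 both coordinates
  have positive real part, away from the jump of \<open>Arg\<close>; on the other piece the cutoff
  vanishes.\<close>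

lemma continuous_on_cutoff_Arg:
  fixes h :: "real \<times> real \<Rightarrow> real"
  assumes "continuous_on UNIV h"
  shows "continuous_on torus (\<lambda>p. cutoff p * h (Arg (fst p), Arg (snd p)))"
proof -
  let ?F = "\<lambda>p. cutoff p * h (Arg (fst p), Arg (snd p))"
  define S1 where "S1 = {p \<in> torus. dist_corner p \<le> 1/2}"
  define S2 where "S2 = {p \<in> torus. dist_corner p \<ge> 1/2}"
  have D: "continuous_on A dist_corner" for A unfolding dist_corner_def by (intro continuous_intros)
  have tc: "closed torus" by (intro closed_Times closed_sphere)
  have "closed S1" "closed S2" unfolding S1_def S2_def
    unfolding Collect_conj_eq Collect_mem_eq by (intro closed_Int tc closed_Collect_le D continuous_on_const)+
  have "continuous_on S1 ?F"
  proof -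
    have pos: "fst p \<notin> \<real>\<^sub>\<le>\<^sub>0 \<and> snd p \<notin> \<real>\<^sub>\<le>\<^sub>0" if "p \<in> S1" for p
    proof -
      have "Re (fst p) \<le> 1" "Re (snd p) \<le> 1"
        using that complex_Re_le_cmod[of "fst p"] complex_Re_le_cmod[of "snd p"] by (auto simp: S1_def)
      then have "Re (fst p) > 0" "Re (snd p) > 0" using that by (auto simp: S1_def dist_corner_def)
      then show ?thesis by (auto simp: complex_nonpos_Reals_iff)
    qed
    have "continuous_on S1 (\<lambda>p. (Arg (fst p), Arg (snd p)))"
      using pos by (intro continuous_intros) auto
    then have "continuous_on S1 (\<lambda>p. h (Arg (fst p), Arg (snd p)))"
      using continuous_on_compose2[OF assms] by blast
    then show ?thesis unfolding cutoff_def by (intro continuous_intros D)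
  qed
  moreover have "continuous_on S2 ?F"
    by (rule continuous_on_eq[of _ "\<lambda>_. 0"]) (auto simp: S2_def cutoff_def)
  ultimately have "continuous_on (S1 \<union> S2) ?F"
    using \<open>closed S1\<close> \<open>closed S2\<close> by (intro continuous_on_closed_Un)
  moreover have "S1 \<union> S2 = torus" by (auto simp: S1_def S2_def)
  ultimately show ?thesis by simp
qed

section \<open>The dual action and its eigencoordinates\<close>

definition lin :: "int \<Rightarrow> int \<Rightarrow> int \<Rightarrow> int \<Rightarrow> int \<times> int \<Rightarrow> int \<times> int" where
  "lin a b c d n = (a * fst n + b * snd n, c * fst n + d * snd n)"

text \<open>The transposed matrix, acting on the plane that covers the dual torus.\<close>

definition lin_dual :: "int \<Rightarrow> int \<Rightarrow> int \<Rightarrow> int \<Rightarrow> real \<times> real \<Rightarrow> real \<times> real" where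
  "lin_dual a b c d x = (of_int a * fst x + of_int c * snd x, of_int b * fst x + of_int d * snd x)"

lemma char2_lin: "char2 x (lin a b c d n) = char2 (lin_dual a b c d x) n"
  by (simp add: char2_def lin_def lin_dual_def algebra_simps)

definition is_eigenvector :: "int \<Rightarrow> int \<Rightarrow> int \<Rightarrow> int \<Rightarrow> real \<Rightarrow> real \<times> real \<Rightarrow> bool" where
  "is_eigenvector a b c d l u \<longleftrightarrow>
     of_int a * fst u + of_int b * snd u = l * fst u \<and> of_int c * fst u + of_int d * snd u = l * snd u"

text \<open>Eigenvectors of a matrix, read as linear functionals, are coordinates that diagonalise
  its transpose.\<close>

lemma eigenvector_lin_dual:
  assumes "is_eigenvector a b c d l u"
  shows "u \<bullet> lin_dual a b c d x = l * (u \<bullet> x)"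
proof -
  have "u \<bullet> lin_dual a b c d x = (of_int a * fst u + of_int b * snd u) * fst x + (of_int c * fst u + of_int d * snd u) * snd x"
    by (simp add: inner_prod_def lin_dual_def algebra_simps)
  also have "\<dots> = (l * fst u) * fst x + (l * snd u) * snd x"
    using assms by (simp add: is_eigenvector_def)
  finally show ?thesis by (simp add: inner_prod_def algebra_simps)
qed

lemma one_minus_cos_le: "1 - cos t \<le> t\<^sup>2 / 2" for t :: real
proof -
  have "(sin (t / 2))\<^sup>2 \<le> (t / 2)\<^sup>2" using abs_sin_x_le_abs_x[of "t / 2"] by (simp only: abs_le_square_iff)
  then show ?thesis using cos_double_sin[of "t / 2"] by (simp add: power_divide)
qed

text \<open>Each coordinate contributes at most (1/2)^2 / 2 = 1/8 to \<open>dist_corner\<close>, so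
  the cutoff is still 1.\<close>

lemma cutoff_Arg_near_zero:
  assumes "\<bar>fst z\<bar> \<le> 1/2" "\<bar>snd z\<bar> \<le> 1/2"
  shows "cutoff (cis2 z) * h (Arg (fst (cis2 z)), Arg (snd (cis2 z))) = (h z :: real)"
proof -
  have "(fst z)\<^sup>2 \<le> (1/2)\<^sup>2" "(snd z)\<^sup>2 \<le> (1/2)\<^sup>2" using assms unfolding abs_le_square_iff[symmetric] by simp_all
  then have "dist_corner (cis2 z) \<le> 1/4"
    using one_minus_cos_le[of "fst z"] one_minus_cos_le[of "snd z"] by (simp add: dist_corner_def power_divide)
  then have "cutoff (cis2 z) = 1" by (simp add: cutoff_def)
  moreover have "Arg (cis (fst z)) = fst z" "Arg (cis (snd z)) = snd z"
    using assms pi_gt3 by (auto intro!: Arg_cis)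
  ultimately show ?thesis by simp
qed

text \<open>P approximates the cut-off direction ratio up to e, and the two evaluations cost 2 e.
  The quantifier order is essential: \<open>\<rho>\<close> and \<open>\<kappa>\<close> must not
  deteriorate as \<open>\<eta>\<close> shrinks.\<close>

lemma hyperbolic_test_poly:
  assumes "l > 1" "is_eigenvector a b c d l u" "is_eigenvector a b c d (1 / l) u'"
  shows "\<exists>\<rho>>0. \<exists>\<kappa>>0. \<forall>\<eta>>0. \<forall>e>0. \<exists>P. trig_poly P \<and> (\<forall>x. \<bar>P (char2 x)\<bar> \<le> 1 + e) \<and>
    (\<forall>y. \<bar>fst y\<bar> \<le> \<rho> \<longrightarrow> \<bar>snd y\<bar> \<le> \<rho> \<longrightarrow>
       P (char2 (lin_dual a b c d y)) - P (char2 y) \<ge> - 2 * e \<and>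
       (y \<bullet> y \<ge> \<eta> \<longrightarrow> P (char2 (lin_dual a b c d y)) - P (char2 y)
           \<ge> \<kappa> * (((u \<bullet> y) * (u' \<bullet> y))\<^sup>2 / (y \<bullet> y)\<^sup>2) - 2 * e))"
proof -
  \<comment> \<open>L bounds the absolute column sums, so the dual action maps the square of radius
    1 / (2 L) into the square of radius 1/2, where the cutoff is 1 and \<open>Arg\<close> recovers
    the coordinates.\<close>
  define L where "L = 1 + real_of_int (\<bar>a\<bar> + \<bar>b\<bar> + \<bar>c\<bar> + \<bar>d\<bar>)"
  have L: "L \<ge> 1" "real_of_int (\<bar>a\<bar> + \<bar>c\<bar>) \<le> L" "real_of_int (\<bar>b\<bar> + \<bar>d\<bar>) \<le> L" by (simp_all add: L_def)
  define \<rho> where "\<rho> = 1 / (2 * L)"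
  have \<rho>: "\<rho> > 0" "\<rho> \<le> 1/2" "L * \<rho> = 1/2" using L by (auto simp: \<rho>_def field_simps)
  \<comment> \<open>By Cauchy-Schwarz, k (y . y) bounds the squares of both eigencoordinates of
    y.\<close>
  define k where "k = u \<bullet> u + u' \<bullet> u'"
  define \<kappa> where "\<kappa> = (l\<^sup>2 - 1 / l\<^sup>2) / (2 * l\<^sup>2 * k + 1)\<^sup>2"
  have k0: "k \<ge> 0" by (simp add: k_def)
  have l2: "l\<^sup>2 > 1" using assms(1) by simp
  have "1 / l\<^sup>2 < 1" using l2 assms(1) by (simp add: divide_simps)
  moreover have "2 * l\<^sup>2 * k + 1 > 0" using k0 by (simp add: add_nonneg_pos)
  ultimately have \<kappa>: "\<kappa> > 0" using l2 unfolding \<kappa>_def by (intro divide_pos_pos) auto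
  have bound: "\<bar>real_of_int p * s + real_of_int q * t\<bar> \<le> 1/2"
    if "\<bar>s\<bar> \<le> \<rho>" "\<bar>t\<bar> \<le> \<rho>" "real_of_int (\<bar>p\<bar> + \<bar>q\<bar>) \<le> L" for p q s t
  proof -
    have "\<bar>real_of_int p * s + real_of_int q * t\<bar> \<le> \<bar>real_of_int p\<bar> * \<bar>s\<bar> + \<bar>real_of_int q\<bar> * \<bar>t\<bar>"
      by (metis abs_mult abs_triangle_ineq)
    also have "\<dots> \<le> \<bar>real_of_int p\<bar> * \<rho> + \<bar>real_of_int q\<bar> * \<rho>"
      using that by (intro add_mono mult_left_mono) auto
    also have "\<dots> = real_of_int (\<bar>p\<bar> + \<bar>q\<bar>) * \<rho>" by (simp add: algebra_simps)
    also have "\<dots> \<le> L * \<rho>" using that \<rho> by (intro mult_right_mono) auto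
    finally show ?thesis using \<rho> by simp
  qed
  have "\<exists>P. trig_poly P \<and> (\<forall>x. \<bar>P (char2 x)\<bar> \<le> 1 + e) \<and>
    (\<forall>y. \<bar>fst y\<bar> \<le> \<rho> \<longrightarrow> \<bar>snd y\<bar> \<le> \<rho> \<longrightarrow>
       P (char2 (lin_dual a b c d y)) - P (char2 y) \<ge> - 2 * e \<and>
       (y \<bullet> y \<ge> \<eta> \<longrightarrow> P (char2 (lin_dual a b c d y)) - P (char2 y)
           \<ge> \<kappa> * (((u \<bullet> y) * (u' \<bullet> y))\<^sup>2 / (y \<bullet> y)\<^sup>2) - 2 * e))"
    if \<eta>: "\<eta> > 0" and e: "e > 0" for \<eta> e
  proof -
    define h where "h y = dirratio \<eta> (u \<bullet> y) (u' \<bullet> y)" for y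
    define F where "F p = cutoff p * h (Arg (fst p), Arg (snd p))" for p
    have h01: "0 \<le> h y" "h y \<le> 1" for y using dirratio_bounds[OF \<eta>] by (auto simp: h_def)
    have "continuous_on UNIV h"
      unfolding h_def dirratio_def using \<eta>
      by (intro continuous_intros) (metis add_nonneg_pos less_irrefl add_nonneg_nonneg zero_le_power2)
    then have "continuous_on torus F" unfolding F_def by (rule continuous_on_cutoff_Arg)
    then obtain P where P: "trig_poly P" "\<And>x. \<bar>F (cis2 x) - P (char2 x)\<bar> < e"
      using trig_poly_dense e by blast
    have F01: "0 \<le> F p \<and> F p \<le> 1" for p
      using h01[of "(Arg (fst p), Arg (snd p))"] unfolding F_def
      by (auto simp: cutoff_def intro!: mult_le_one)
    have "\<bar>P (char2 x)\<bar> \<le> 1 + e" for x using P(2)[of x] F01[of "cis2 x"] by linarith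
    moreover have "P (char2 (lin_dual a b c d y)) - P (char2 y) \<ge> - 2 * e \<and>
       (y \<bullet> y \<ge> \<eta> \<longrightarrow> P (char2 (lin_dual a b c d y)) - P (char2 y)
           \<ge> \<kappa> * (((u \<bullet> y) * (u' \<bullet> y))\<^sup>2 / (y \<bullet> y)\<^sup>2) - 2 * e)"
      if y: "\<bar>fst y\<bar> \<le> \<rho>" "\<bar>snd y\<bar> \<le> \<rho>" for y
    proof -
      let ?z = "lin_dual a b c d y"
      have Fy: "F (cis2 y) = h y"
        unfolding F_def using y \<rho>(2) by (intro cutoff_Arg_near_zero) linarith+
      have Fz: "F (cis2 ?z) = h ?z"
        unfolding F_def using bound[OF y] L(2,3)
        by (intro cutoff_Arg_near_zero) (simp_all add: lin_dual_def)
      have hz: "h ?z = dirratio \<eta> (l * (u \<bullet> y)) (u' \<bullet> y / l)"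
        unfolding h_def using eigenvector_lin_dual[OF assms(2)] eigenvector_lin_dual[OF assms(3)] by simp
      have hy: "h y = dirratio \<eta> (u \<bullet> y) (u' \<bullet> y)" by (simp add: h_def)
      have "(l\<^sup>2 - 1 / l\<^sup>2) \<ge> 0" using l2 \<open>1 / l\<^sup>2 < 1\<close> by linarith
      then have "h ?z - h y \<ge> 0"
        using \<eta> unfolding hz hy
        by (intro order_trans[OF _ dirratio_increase[OF \<eta> assms(1), of "u \<bullet> y" "u' \<bullet> y"]]
              divide_nonneg_nonneg mult_nonneg_nonneg) auto
      moreover have "h ?z - h y \<ge> \<kappa> * (((u \<bullet> y) * (u' \<bullet> y))\<^sup>2 / (y \<bullet> y)\<^sup>2)" if "y \<bullet> y \<ge> \<eta>"
      proof -
        have "(u \<bullet> y)\<^sup>2 \<le> k * (y \<bullet> y)" "(u' \<bullet> y)\<^sup>2 \<le> k * (y \<bullet> y)"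
          using Cauchy_Schwarz_ineq[of u y] Cauchy_Schwarz_ineq[of u' y]
            mult_nonneg_nonneg[OF inner_ge_zero[of u] inner_ge_zero[of y]]
            mult_nonneg_nonneg[OF inner_ge_zero[of u'] inner_ge_zero[of y]]
          unfolding k_def distrib_right by linarith+
        then show ?thesis
          unfolding hz hy \<kappa>_def using dirratio_increase_quantitative[OF \<eta> assms(1) that] by blast
      qed
      ultimately show ?thesis using P(2)[of y] P(2)[of ?z] unfolding Fy Fz by (auto simp: abs_less_iff)
    qed
    ultimately show ?thesis using P(1) by blast
  qed
  then show ?thesis using \<rho>(1) \<kappa> by blast
qed

text \<open>The expression is homogeneous of degree 0, so its minimum on the compact unit circle
  serves everywhere.\<close>

lemma quartic_lower_bound:
  fixes u1 v1 u2 v2 :: "real \<times> real"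
  assumes "\<And>y. y \<noteq> 0 \<Longrightarrow> (u1 \<bullet> y) * (v1 \<bullet> y) \<noteq> 0 \<or> (u2 \<bullet> y) * (v2 \<bullet> y) \<noteq> 0"
  shows "\<exists>m>0. \<forall>y. y \<noteq> 0 \<longrightarrow> m \<le> ((u1 \<bullet> y) * (v1 \<bullet> y))\<^sup>2 / (y \<bullet> y)\<^sup>2 + ((u2 \<bullet> y) * (v2 \<bullet> y))\<^sup>2 / (y \<bullet> y)\<^sup>2"
proof -
  define q where "q y = ((u1 \<bullet> y) * (v1 \<bullet> y))\<^sup>2 + ((u2 \<bullet> y) * (v2 \<bullet> y))\<^sup>2" for y
  have "continuous_on (sphere 0 1) q" unfolding q_def by (intro continuous_intros)
  moreover have "(1, 0) \<in> sphere (0 :: real \<times> real) 1" by (simp add: norm_Pair)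
  ultimately obtain p where p: "p \<in> sphere 0 1" "\<And>y. y \<in> sphere 0 1 \<Longrightarrow> q p \<le> q y"
    using continuous_attains_inf[OF compact_sphere] by (metis empty_iff)
  have "p \<noteq> 0" using p(1) by auto
  then have "q p > 0" using assms[of p] unfolding q_def
    by (metis add_nonneg_eq_0_iff less_le zero_le_power2 power_eq_0_iff add_nonneg_nonneg)
  moreover have "q p \<le> ((u1 \<bullet> y) * (v1 \<bullet> y))\<^sup>2 / (y \<bullet> y)\<^sup>2 + ((u2 \<bullet> y) * (v2 \<bullet> y))\<^sup>2 / (y \<bullet> y)\<^sup>2" if "y \<noteq> 0" for y
  proof -
    have "q p \<le> q (y /\<^sub>R norm y)" using that by (intro p(2)) simp
    also have "q (y /\<^sub>R norm y) = q y / (norm y ^ 2)\<^sup>2"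
      using that by (simp add: q_def field_simps power2_eq_square)
    finally show ?thesis by (simp add: q_def power2_norm_eq_inner add_divide_distrib)
  qed
  ultimately show ?thesis by blast
qed

text \<open>Near the corner of the torus, x is replaced by its representative y with coordinates in
  (-pi, pi]. The dual actions respect this because their matrices are integral.\<close>

lemma dist_corner_ge_or_near_zero:
  assumes "\<rho> > 0"
  shows "\<exists>\<delta>>0. \<forall>x. dist_corner (cis2 x) \<ge> \<delta> \<or> (\<exists>y. char2 y = char2 x \<and> char2 (lin_dual a b c d y) = char2 (lin_dual a b c d x)
     \<and> char2 (lin_dual a' b' c' d' y) = char2 (lin_dual a' b' c' d' x) \<and> \<bar>fst y\<bar> \<le> \<rho> \<and> \<bar>snd y\<bar> \<le> \<rho>)"
proof -
  \<comment> \<open>The cap at 1 keeps the radius inside [0, pi], where cosine decreases.\<close>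
  define \<rho>' where "\<rho>' = min \<rho> 1"
  have \<rho>': "\<rho>' > 0" "\<rho>' \<le> pi" "\<rho>' \<le> \<rho>" using assms pi_gt3 by (auto simp: \<rho>'_def)
  define \<delta> where "\<delta> = 1 - cos \<rho>'"
  have "cos \<rho>' < cos 0" using \<rho>' by (intro cos_monotone_0_pi) auto
  then have "\<delta> > 0" by (simp add: \<delta>_def)
  have small: "\<bar>t\<bar> \<le> \<rho>" if "cos t > cos \<rho>'" "\<bar>t\<bar> \<le> pi" for t
  proof (rule ccontr)
    assume "\<not> \<bar>t\<bar> \<le> \<rho>"
    then have "cos \<bar>t\<bar> \<le> cos \<rho>'" using \<rho>' that by (intro cos_monotone_0_pi_le) auto
    then show False using that(1) by simp
  qed
  have "dist_corner (cis2 x) \<ge> \<delta> \<or> (\<exists>y. char2 y = char2 x \<and> char2 (lin_dual a b c d y) = char2 (lin_dual a b c d x)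
     \<and> char2 (lin_dual a' b' c' d' y) = char2 (lin_dual a' b' c' d' x) \<and> \<bar>fst y\<bar> \<le> \<rho> \<and> \<bar>snd y\<bar> \<le> \<rho>)" for x
  proof (cases "dist_corner (cis2 x) \<ge> \<delta>")
    case False
    define y where "y = (Arg (cis (fst x)), Arg (cis (snd x)))"
    have cis: "cis (fst y) = cis (fst x)" "cis (snd y) = cis (snd x)"
      using cis_Arg[of "cis (fst x)"] cis_Arg[of "cis (snd x)"] by (simp_all add: y_def sgn_div_norm)
    have "char2 y n = char2 x n" for n
    proof -
      have "char2 z n = cis (fst z) powi fst n * cis (snd z) powi snd n" for z
        by (simp add: char2_def cis_mult[symmetric] cis_power_int mult.commute)
      then show ?thesis by (simp add: cis)
    qed
    then have ch: "char2 y = char2 x" by (rule ext)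
    have lin: "char2 (lin_dual p q r s y) = char2 (lin_dual p q r s x)" for p q r s
      by (rule ext) (simp add: char2_lin[symmetric] ch)
    have "cos (fst y) = cos (fst x)" "cos (snd y) = cos (snd x)" using cis by (metis cis.sel(1))+
    moreover note cos_le_one[of "fst x"] cos_le_one[of "snd x"]
    ultimately have "cos (fst y) > cos \<rho>'" "cos (snd y) > cos \<rho>'"
      using False unfolding dist_corner_def \<delta>_def fst_conv snd_conv cis.sel by linarith+
    moreover have "\<bar>fst y\<bar> \<le> pi" "\<bar>snd y\<bar> \<le> pi"
      using Arg_bounded[of "cis (fst x)"] Arg_bounded[of "cis (snd x)"] by (auto simp: y_def)
    ultimately show ?thesis using ch lin small by blast
  qed simp
  with \<open>\<delta> > 0\<close> show ?thesis by blast
qed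

text \<open>Continuity at the origin. The value 1/4 is matched to the factor 4 of
  \<open>\<Psi>\<close> in the main inequality, where it yields 1.\<close>

lemma trig_poly_near_corner:
  assumes "trig_poly \<Psi>" "\<Psi> (char2 0) = 1"
  shows "\<exists>\<eta>>0. \<forall>y. y \<bullet> y < \<eta> \<longrightarrow> \<Psi> (char2 y) \<ge> 1/4"
proof -
  have "isCont (\<lambda>x. \<Psi> (char2 x)) 0"
    using trig_poly_continuous[OF assms(1), of UNIV] by (simp add: continuous_on_eq_continuous_at del: split_paired_All)
  then obtain r where r: "r > 0" "\<And>y. dist y 0 < r \<Longrightarrow> dist (\<Psi> (char2 y)) (\<Psi> (char2 0)) < 1/2"
    unfolding continuous_at_eps_delta by (metis half_gt_zero zero_less_one)
  show ?thesis
  proof (intro exI[of _ "r\<^sup>2"] conjI allI impI)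
    fix y :: "real \<times> real" assume "y \<bullet> y < r\<^sup>2"
    then have "norm y < r" using r(1) by (metis power2_norm_eq_inner power2_less_imp_less less_le)
    then have "\<bar>\<Psi> (char2 y) - 1\<bar> < 1/2" using r(2)[of y] assms(2) by (simp add: dist_real_def)
    then show "\<Psi> (char2 y) \<ge> 1/4" by linarith
  qed (use r in simp)
qed

text \<open>The polynomials witnessing that the torus carries no probability measure which is almost invariant
  under two independent hyperbolic matrices, concentrated near the origin and without an atom there:
  along a hyperbolic matrix the ratio \<open>s\<^sup>2 / (s\<^sup>2 + t\<^sup>2)\<close> of its eigencoordinates increases
  except on the eigenlines, which are not shared by the other matrix.\<close>

lemma two_hyperbolic_inequality:
  assumes "l > 1"
    and ev: "is_eigenvector a b c d l u" "is_eigenvector a b c d (1 / l) v"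
      "is_eigenvector a' b' c' d' l u'" "is_eigenvector a' b' c' d' (1 / l) v'"
    and indep: "\<forall>y. y \<noteq> 0 \<longrightarrow> (u \<bullet> y) * (v \<bullet> y) \<noteq> 0 \<or> (u' \<bullet> y) * (v' \<bullet> y) \<noteq> 0"
  shows "\<exists>C>0. \<exists>C'\<ge>0. \<forall>\<Psi>. trig_poly \<Psi> \<longrightarrow> (\<forall>x. \<Psi> (char2 x) \<ge> 0) \<longrightarrow> \<Psi> (char2 0) = 1 \<longrightarrow>
    (\<exists>P P'. trig_poly P \<and> trig_poly P' \<and> (\<forall>x. \<bar>P (char2 x)\<bar> \<le> 2) \<and> (\<forall>x. \<bar>P' (char2 x)\<bar> \<le> 2) \<and>
      (\<forall>x. 1/2 \<le> C * ((P (char2 (lin_dual a b c d x)) - P (char2 x))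
           + (P' (char2 (lin_dual a' b' c' d' x)) - P' (char2 x)))
         + C' * dist_corner (cis2 x) + 4 * \<Psi> (char2 x)))"
proof -
  obtain r1 k1 where r1: "r1 > 0" "k1 > 0" and t1: "\<forall>\<eta>>0. \<forall>e>0. \<exists>P. trig_poly P \<and> (\<forall>x. \<bar>P (char2 x)\<bar> \<le> 1 + e) \<and>
    (\<forall>y. \<bar>fst y\<bar> \<le> r1 \<longrightarrow> \<bar>snd y\<bar> \<le> r1 \<longrightarrow>
       P (char2 (lin_dual a b c d y)) - P (char2 y) \<ge> - 2 * e \<and>
       (y \<bullet> y \<ge> \<eta> \<longrightarrow> P (char2 (lin_dual a b c d y)) - P (char2 y)
           \<ge> k1 * (((u \<bullet> y) * (v \<bullet> y))\<^sup>2 / (y \<bullet> y)\<^sup>2) - 2 * e))"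
    using hyperbolic_test_poly[OF assms(1) ev(1,2)] by (elim exE conjE) (rule that)
  obtain r2 k2 where r2: "r2 > 0" "k2 > 0" and t2: "\<forall>\<eta>>0. \<forall>e>0. \<exists>P. trig_poly P \<and> (\<forall>x. \<bar>P (char2 x)\<bar> \<le> 1 + e) \<and>
    (\<forall>y. \<bar>fst y\<bar> \<le> r2 \<longrightarrow> \<bar>snd y\<bar> \<le> r2 \<longrightarrow>
       P (char2 (lin_dual a' b' c' d' y)) - P (char2 y) \<ge> - 2 * e \<and>
       (y \<bullet> y \<ge> \<eta> \<longrightarrow> P (char2 (lin_dual a' b' c' d' y)) - P (char2 y)
           \<ge> k2 * (((u' \<bullet> y) * (v' \<bullet> y))\<^sup>2 / (y \<bullet> y)\<^sup>2) - 2 * e))"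
    using hyperbolic_test_poly[OF assms(1) ev(3,4)] by (elim exE conjE) (rule that)
  obtain m where m: "m > 0" "\<And>y. y \<noteq> 0 \<Longrightarrow>
     m \<le> ((u \<bullet> y) * (v \<bullet> y))\<^sup>2 / (y \<bullet> y)\<^sup>2 + ((u' \<bullet> y) * (v' \<bullet> y))\<^sup>2 / (y \<bullet> y)\<^sup>2"
    using quartic_lower_bound[OF indep[rule_format]] by blast
  define k where "k = min k1 k2"
  define \<rho> where "\<rho> = min r1 r2"
  have k: "k > 0" and \<rho>: "\<rho> > 0" using r1 r2 by (auto simp: k_def \<rho>_def)
  obtain \<delta> where \<delta>: "\<delta> > 0" "\<And>x. dist_corner (cis2 x) \<ge> \<delta> \<or>
     (\<exists>y. char2 y = char2 x \<and> char2 (lin_dual a b c d y) = char2 (lin_dual a b c d x)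
     \<and> char2 (lin_dual a' b' c' d' y) = char2 (lin_dual a' b' c' d' x) \<and> \<bar>fst y\<bar> \<le> \<rho> \<and> \<bar>snd y\<bar> \<le> \<rho>)"
    using dist_corner_ge_or_near_zero[OF \<rho>, of a b c d a' b' c' d'] by (elim exE conjE) (rule that, assumption, blast)
  \<comment> \<open>Normalises the guaranteed gain k m to 1.\<close>
  define C where "C = 1 / (k * m)"
  have C: "C > 0" "C * (k * m) = 1" using k m(1) by (auto simp: C_def)
  \<comment> \<open>The approximation errors add up to 4 e; with C e at most 1/8 they cost at most
    1/2 of the normalised gain, and e at most 1 bounds the polynomials by 2.\<close>
  define e where "e = min 1 (1 / (8 * C))"
  have e: "e > 0" "e \<le> 1" using C by (auto simp: e_def)
  have "C * e \<le> C * (1 / (8 * C))" using C(1) by (intro mult_left_mono) (auto simp: e_def)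
  then have Ce: "C * e \<le> 1/8" using C(1) by simp
  \<comment> \<open>Away from the corner the four values of P and P' are only known to be bounded by
    2, so C times their combination may reach -8 C; the distance term compensates this and leaves
    1.\<close>
  define C' where "C' = (8 * C + 1) / \<delta>"
  have C': "C' \<ge> 0" "C' * \<delta> = 8 * C + 1" using C \<delta>(1) by (auto simp: C'_def)
  have "\<exists>P P'. trig_poly P \<and> trig_poly P' \<and> (\<forall>x. \<bar>P (char2 x)\<bar> \<le> 2) \<and> (\<forall>x. \<bar>P' (char2 x)\<bar> \<le> 2) \<and>
      (\<forall>x. 1/2 \<le> C * ((P (char2 (lin_dual a b c d x)) - P (char2 x))
           + (P' (char2 (lin_dual a' b' c' d' x)) - P' (char2 x)))
         + C' * dist_corner (cis2 x) + 4 * \<Psi> (char2 x))"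
    if \<Psi>: "trig_poly \<Psi>" "\<And>x. \<Psi> (char2 x) \<ge> 0" "\<Psi> (char2 0) = 1" for \<Psi>
  proof -
    obtain \<eta> where \<eta>: "\<eta> > 0" "\<And>y. y \<bullet> y < \<eta> \<Longrightarrow> \<Psi> (char2 y) \<ge> 1/4"
      using trig_poly_near_corner[OF \<Psi>(1,3)] by blast
    obtain P where P: "trig_poly P" "\<And>x. \<bar>P (char2 x)\<bar> \<le> 1 + e"
      "\<And>y. \<bar>fst y\<bar> \<le> r1 \<Longrightarrow> \<bar>snd y\<bar> \<le> r1 \<Longrightarrow>
       P (char2 (lin_dual a b c d y)) - P (char2 y) \<ge> - 2 * e \<and>
       (y \<bullet> y \<ge> \<eta> \<longrightarrow> P (char2 (lin_dual a b c d y)) - P (char2 y)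
           \<ge> k1 * (((u \<bullet> y) * (v \<bullet> y))\<^sup>2 / (y \<bullet> y)\<^sup>2) - 2 * e)"
      using t1[THEN spec, THEN mp, OF \<eta>(1), THEN spec, THEN mp, OF e(1)]
      by (elim exE conjE) (rule that, assumption, blast, blast)
    obtain P' where P': "trig_poly P'" "\<And>x. \<bar>P' (char2 x)\<bar> \<le> 1 + e"
      "\<And>y. \<bar>fst y\<bar> \<le> r2 \<Longrightarrow> \<bar>snd y\<bar> \<le> r2 \<Longrightarrow>
       P' (char2 (lin_dual a' b' c' d' y)) - P' (char2 y) \<ge> - 2 * e \<and>
       (y \<bullet> y \<ge> \<eta> \<longrightarrow> P' (char2 (lin_dual a' b' c' d' y)) - P' (char2 y)
           \<ge> k2 * (((u' \<bullet> y) * (v' \<bullet> y))\<^sup>2 / (y \<bullet> y)\<^sup>2) - 2 * e)"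
      using t2[THEN spec, THEN mp, OF \<eta>(1), THEN spec, THEN mp, OF e(1)]
      by (elim exE conjE) (rule that, assumption, blast, blast)
    define S where "S x = (P (char2 (lin_dual a b c d x)) - P (char2 x))
           + (P' (char2 (lin_dual a' b' c' d' x)) - P' (char2 x))" for x
    have D0: "dist_corner (cis2 x) \<ge> 0" for x
      using cos_le_one[of "fst x"] cos_le_one[of "snd x"] by (simp add: dist_corner_def del: cos_le_one)
    \<comment> \<open>Three regions: away from the corner the distance term dominates; near it but
      with y . y at least \<open>\<eta>\<close>, one of the two matrices gains; in the remaining
      disc \<open>\<Psi>\<close> is at least 1/4.\<close>
    have "1/2 \<le> C * S x + C' * dist_corner (cis2 x) + 4 * \<Psi> (char2 x)" for x
      using \<delta>(2)[of x]
    proof (elim disjE exE conjE)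
      assume D: "dist_corner (cis2 x) \<ge> \<delta>"
      have "S x \<ge> - 8"
        using P(2)[of x] P(2)[of "lin_dual a b c d x"] P'(2)[of x] P'(2)[of "lin_dual a' b' c' d' x"] e(2)
        unfolding S_def by linarith
      then have "C * S x \<ge> C * (- 8)" using C(1) by (intro mult_left_mono) auto
      moreover have "C' * dist_corner (cis2 x) \<ge> C' * \<delta>" using D C'(1) by (intro mult_left_mono)
      ultimately show ?thesis using C'(2) \<Psi>(2)[of x] by linarith
    next
      fix y assume y: "char2 y = char2 x" "char2 (lin_dual a b c d y) = char2 (lin_dual a b c d x)"
        "char2 (lin_dual a' b' c' d' y) = char2 (lin_dual a' b' c' d' x)" "\<bar>fst y\<bar> \<le> \<rho>" "\<bar>snd y\<bar> \<le> \<rho>"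
      have Sx: "S x = S y" by (simp add: S_def y)
      have yr: "\<bar>fst y\<bar> \<le> r1" "\<bar>snd y\<bar> \<le> r1" "\<bar>fst y\<bar> \<le> r2" "\<bar>snd y\<bar> \<le> r2" using y by (auto simp: \<rho>_def)
      note Py = P(3)[OF yr(1,2)] and Py' = P'(3)[OF yr(3,4)]
      have CD: "C' * dist_corner (cis2 x) \<ge> 0" using D0 C'(1) by simp
      show ?thesis
      proof (cases "y \<bullet> y \<ge> \<eta>")
        case True
        then have y0: "y \<noteq> 0" using \<eta>(1) by auto
        have "k * m \<le> k * (((u \<bullet> y) * (v \<bullet> y))\<^sup>2 / (y \<bullet> y)\<^sup>2) + k * (((u' \<bullet> y) * (v' \<bullet> y))\<^sup>2 / (y \<bullet> y)\<^sup>2)"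
          using m(2)[OF y0] k unfolding distrib_left[symmetric] by (intro mult_left_mono) auto
        also have "\<dots> \<le> k1 * (((u \<bullet> y) * (v \<bullet> y))\<^sup>2 / (y \<bullet> y)\<^sup>2) + k2 * (((u' \<bullet> y) * (v' \<bullet> y))\<^sup>2 / (y \<bullet> y)\<^sup>2)"
          by (intro add_mono mult_right_mono) (auto simp: k_def)
        finally have "S y \<ge> k * m - 4 * e" using Py Py' True unfolding S_def by linarith
        then have "C * S y \<ge> C * (k * m - 4 * e)" using C(1) by (intro mult_left_mono) auto
        also have "C * (k * m - 4 * e) = 1 - 4 * (C * e)" using C(2) by (simp add: algebra_simps)
        finally show ?thesis using Ce CD \<Psi>(2)[of x] unfolding Sx by linarith
      next
        case False
        then have "\<Psi> (char2 x) \<ge> 1/4" using \<eta>(2)[of y] y(1) by simp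
        moreover have "S y \<ge> - 4 * e" using Py Py' unfolding S_def by linarith
        then have "C * S y \<ge> C * (- 4 * e)" using C(1) by (intro mult_left_mono) auto
        ultimately show ?thesis using Ce CD unfolding Sx by linarith
      qed
    qed
    then show ?thesis
      using P(1,2) P'(1,2) e(2) unfolding S_def
      by (intro exI[of _ P] exI[of _ P'] conjI allI) (auto intro: order_trans[of _ "1 + e"])
  qed
  then show ?thesis using C(1) C'(1) by blast
qed

section \<open>An obstruction to the Haagerup property\<close>

text \<open>The estimate of an integral by supremum times total mass: nonnegativity is applied to B
  + P and B - P.\<close>

lemma pd_fun_bound:
  assumes "trig_poly P" "pd_fun \<psi>" "\<And>x. \<bar>P (char2 x)\<bar> \<le> B"
  shows "\<bar>P \<psi>\<bar> \<le> B * Re (\<psi> 0)"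
proof -
  have "trig_poly (\<lambda>\<psi>. B * Re (\<psi> 0) + P \<psi>)" "trig_poly (\<lambda>\<psi>. B * Re (\<psi> 0) - P \<psi>)"
    by (intro trig_poly.add trig_poly_diff trig_poly_scale trig_poly_Re assms(1))+
  moreover have "B * Re (char2 x 0) + P (char2 x) \<ge> 0" "B * Re (char2 x 0) - P (char2 x) \<ge> 0" for x
    using assms(3)[of x] unfolding char2_zero by simp_all
  ultimately have "B * Re (\<psi> 0) + P \<psi> \<ge> 0" "B * Re (\<psi> 0) - P \<psi> \<ge> 0"
    using trig_poly_nonneg[OF _ assms(2)] by fast+
  then show ?thesis by linarith
qed

lemma positive_definite_family:
  fixes G (structure) and x :: "'i \<Rightarrow> 'a"
  assumes "positive_definite G \<phi>" "finite I" "x ` I \<subseteq> carrier G"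
  shows "(\<Sum>i\<in>I. \<Sum>j\<in>I. cnj (c i) * c j * \<phi> (inv x i \<otimes> x j)) \<in> \<real>\<^sub>\<ge>\<^sub>0"
proof -
  define d where "d g = (\<Sum>i\<in>{i\<in>I. x i = g}. c i)" for g
  have cnj_d: "cnj (d g) = (\<Sum>i\<in>{i\<in>I. x i = g}. cnj (c i))" for g by (simp add: d_def)
  have "(\<Sum>i\<in>I. \<Sum>j\<in>I. cnj (c i) * c j * \<phi> (inv x i \<otimes> x j))
      = (\<Sum>i\<in>I. \<Sum>h\<in>x`I. cnj (c i) * d h * \<phi> (inv x i \<otimes> h))"
    by (subst sum.image_gen[OF assms(2), of _ x])
       (auto intro!: sum.cong simp: d_def sum_distrib_left sum_distrib_right)
  also have "\<dots> = (\<Sum>h\<in>x`I. \<Sum>i\<in>I. cnj (c i) * d h * \<phi> (inv x i \<otimes> h))"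
    by (rule sum.swap)
  also have "\<dots> = (\<Sum>h\<in>x`I. \<Sum>g\<in>x`I. cnj (d g) * d h * \<phi> (inv g \<otimes> h))"
    by (rule sum.cong[OF refl], subst sum.image_gen[OF assms(2), of _ x])
       (auto intro!: sum.cong simp: cnj_d sum_distrib_right)
  also have "\<dots> = (\<Sum>g\<in>x`I. \<Sum>h\<in>x`I. cnj (d g) * d h * \<phi> (inv g \<otimes> h))"
    by (rule sum.swap)
  also have "\<dots> \<in> \<real>\<^sub>\<ge>\<^sub>0"
    using assms(2,3) by (intro assms(1)[unfolded positive_definite_def, rule_format] conjI) auto
  finally show ?thesis .
qed

text \<open>In the GNS representation this is the coefficient of the vector that is the sum over k
  of u k times the translate of the cyclic vector by y k, restricted along
  \<open>\<iota>\<close>.\<close>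

lemma (in group) pd_fun_vector_state:
  fixes \<iota> :: "'c::ab_group_add \<Rightarrow> 'a"
  assumes "positive_definite G \<phi>"
    and \<iota>: "\<And>n. \<iota> n \<in> carrier G" "\<And>m n. \<iota> (m + n) = \<iota> m \<otimes> \<iota> n"
    and K: "finite K" "y ` K \<subseteq> carrier G"
  shows "pd_fun (\<lambda>n. \<Sum>k\<in>K. \<Sum>l\<in>K. cnj (u k) * u l * \<phi> (inv y k \<otimes> \<iota> n \<otimes> y l))"
  unfolding pd_fun_def
proof (intro allI impI)
  fix F :: "'c set" and c :: "'c \<Rightarrow> complex" assume F: "finite F"
  have \<iota>0: "\<iota> 0 = \<one>" using \<iota>(1)[of 0] \<iota>(2)[of 0 0] by (metis add.right_neutral l_cancel_one)
  have \<iota>m: "inv \<iota> m = \<iota> (- m)" for m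
    using \<iota>(2)[of "- m" m] \<iota>0 by (intro inv_equality) (auto simp: \<iota>(1))
  have sum_pairs: "(\<Sum>a\<in>A. \<Sum>b\<in>B. f a b) = (\<Sum>p\<in>A \<times> B. f (fst p) (snd p))"
    for A :: "'x set" and B :: "'y set" and f :: "'x \<Rightarrow> 'y \<Rightarrow> complex"
    by (simp add: sum.cartesian_product case_prod_beta)
  have yK: "k \<in> K \<Longrightarrow> y k \<in> carrier G" for k using K by auto
  have "(\<Sum>g\<in>F. \<Sum>h\<in>F. cnj (c g) * c h * (\<Sum>k\<in>K. \<Sum>l\<in>K. cnj (u k) * u l * \<phi> (inv y k \<otimes> \<iota> (h - g) \<otimes> y l)))
     = (\<Sum>g\<in>F. \<Sum>h\<in>F. \<Sum>k\<in>K. \<Sum>l\<in>K. cnj (c g * u k) * (c h * u l) * \<phi> (inv (\<iota> g \<otimes> y k) \<otimes> (\<iota> h \<otimes> y l)))"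
    unfolding sum_distrib_left
  proof (intro sum.cong refl)
    fix g h k l assume "k \<in> K" "l \<in> K"
    then have "inv (\<iota> g \<otimes> y k) \<otimes> (\<iota> h \<otimes> y l) = inv y k \<otimes> (\<iota> (- g) \<otimes> \<iota> h) \<otimes> y l"
      using yK \<iota>(1) by (simp add: inv_mult_group m_assoc \<iota>m)
    also have "\<iota> (- g) \<otimes> \<iota> h = \<iota> (h - g)" using \<iota>(2)[of "- g" h] by simp
    finally show "cnj (c g) * c h * (cnj (u k) * u l * \<phi> (inv y k \<otimes> \<iota> (h - g) \<otimes> y l))
      = cnj (c g * u k) * (c h * u l) * \<phi> (inv (\<iota> g \<otimes> y k) \<otimes> (\<iota> h \<otimes> y l))" by simp
  qed
  also have "\<dots> = (\<Sum>g\<in>F. \<Sum>k\<in>K. \<Sum>h\<in>F. \<Sum>l\<in>K. cnj (c g * u k) * (c h * u l) * \<phi> (inv (\<iota> g \<otimes> y k) \<otimes> (\<iota> h \<otimes> y l)))"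
    by (intro sum.cong refl sum.swap)
  also have "\<dots> = (\<Sum>p\<in>F \<times> K. \<Sum>q\<in>F \<times> K. cnj (c (fst p) * u (snd p)) * (c (fst q) * u (snd q))
      * \<phi> (inv (\<iota> (fst p) \<otimes> y (snd p)) \<otimes> (\<iota> (fst q) \<otimes> y (snd q))))"
    by (rule trans[OF sum_pairs], rule sum.cong[OF refl], rule sum_pairs)
  also have "\<dots> \<in> \<real>\<^sub>\<ge>\<^sub>0"
    by (rule positive_definite_family[OF assms(1), where x = "\<lambda>p. \<iota> (fst p) \<otimes> y (snd p)"
          and c = "\<lambda>p. c (fst p) * u (snd p)"])
       (use F K yK \<iota>(1) in auto)
  finally show "(\<Sum>g\<in>F. \<Sum>h\<in>F. cnj (c g) * c h * (\<Sum>k\<in>K. \<Sum>l\<in>K. cnj (u k) * u l * \<phi> (inv y k \<otimes> \<iota> (h - g) \<otimes> y l))) \<in> \<real>\<^sub>\<ge>\<^sub>0" .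
qed

text \<open>In the GNS space, with \<open>\<xi>\<close> the cyclic vector, \<open>\<xi>' = g\<^sup>-\<^sup>1 \<xi>\<close> and \<open>T\<close> the self-adjoint operator given by \<open>P\<close>,
  the left hand side is \<open>\<langle>\<xi>', T \<xi>'\<rangle> - \<langle>\<xi>, T \<xi>\<rangle> = Re \<langle>\<xi>' - \<xi>, T (\<xi>' + \<xi>)\<rangle>\<close>. Polarisation with the weights \<open>s\<close> and
  \<open>1 / s\<close> replaces the Cauchy-Schwarz inequality.\<close>

lemma (in group) almost_invariance:
  fixes \<iota> :: "int \<times> int \<Rightarrow> 'a"
  assumes "positive_definite G \<phi>"
    and \<iota>: "\<And>n. \<iota> n \<in> carrier G" "\<And>m n. \<iota> (m + n) = \<iota> m \<otimes> \<iota> n"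
    and g: "g \<in> carrier G" "\<And>n. g \<otimes> \<iota> n = \<iota> (H n) \<otimes> g"
    and P: "trig_poly P" "\<And>x. \<bar>P (char2 x)\<bar> \<le> B" and s: "s > 0"
  shows "P (\<lambda>n. \<phi> (\<iota> (H n))) - P (\<lambda>n. \<phi> (\<iota> n))
    \<le> B * (s\<^sup>2 * (Re (\<phi> \<one>) - (Re (\<phi> g) + Re (\<phi> (inv g))) / 2)
        + (1 / s\<^sup>2) * (Re (\<phi> \<one>) + (Re (\<phi> g) + Re (\<phi> (inv g))) / 2))"
proof -
  define t where "t = 1 / s"
  define e where "e = s\<^sup>2 * (Re (\<phi> \<one>) - (Re (\<phi> g) + Re (\<phi> (inv g))) / 2)
        + t\<^sup>2 * (Re (\<phi> \<one>) + (Re (\<phi> g) + Re (\<phi> (inv g))) / 2)"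
  have st: "s * t = 1" "t\<^sup>2 = 1 / s\<^sup>2" using s by (auto simp: t_def power_divide)
  have \<iota>0: "\<iota> 0 = \<one>" using \<iota>(1)[of 0] \<iota>(2)[of 0 0] by (metis add.right_neutral l_cancel_one)
  have conj: "g \<otimes> \<iota> n \<otimes> inv g = \<iota> (H n)" for n
    using g \<iota>(1) by (simp add: m_assoc)
  \<comment> \<open>The coefficient of the vector \<open>u \<xi>' + v \<xi>\<close>, written in the
    nested form that \<open>trig_poly_linear\<close> can split.\<close>
  define \<psi> where "\<psi> u v = (\<lambda>n. of_real (u\<^sup>2) * \<phi> (\<iota> (H n)) + (of_real (u * v) * (\<phi> (g \<otimes> \<iota> n) + \<phi> (\<iota> n \<otimes> inv g))
     + (of_real (v\<^sup>2) * \<phi> (\<iota> n) + 0)))" for u v :: real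
  have pd: "pd_fun (\<psi> u v)" for u v
  proof -
    have eq: "\<psi> u v = (\<lambda>n. \<Sum>k\<in>UNIV. \<Sum>l\<in>UNIV. cnj (of_real (if k then u else v)) * of_real (if l then u else v)
        * \<phi> (inv (if k then inv g else \<one>) \<otimes> \<iota> n \<otimes> (if l then inv g else \<one>)))"
      using g(1) \<iota>(1) by (simp add: \<psi>_def UNIV_bool conj fun_eq_iff power2_eq_square algebra_simps)
    show ?thesis
      unfolding eq by (rule pd_fun_vector_state[OF assms(1) \<iota>]) (use g in auto)
  qed
  let ?X = "P (\<lambda>n. \<phi> (\<iota> (H n)))" and ?Y = "P (\<lambda>n. \<phi> (g \<otimes> \<iota> n) + \<phi> (\<iota> n \<otimes> inv g))"
    and ?Z = "P (\<lambda>n. \<phi> (\<iota> n))"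
  have P\<psi>: "P (\<psi> u v) = u\<^sup>2 * ?X + u * v * ?Y + v\<^sup>2 * ?Z" for u v
    unfolding \<psi>_def trig_poly_linear[OF P(1)] trig_poly_of_zero[OF P(1)] by simp
  have H0: "\<iota> (H 0) = \<one>" using conj[of 0] g(1) by (simp add: \<iota>0)
  have \<psi>0: "Re (\<psi> u v 0) = (u\<^sup>2 + v\<^sup>2) * Re (\<phi> \<one>) + u * v * (Re (\<phi> g) + Re (\<phi> (inv g)))" for u v
    using g(1) unfolding \<psi>_def H0 \<iota>0 by (simp add: algebra_simps)
  \<comment> \<open>With \<open>a = \<xi>' - \<xi>\<close> and \<open>b = \<xi>' + \<xi>\<close>,
    the two vectors are s a + t b and s a - t b. The difference of their T-values is 4 s t Re <a, T
    b>, and the sum of their squared norms is 2 (s^2 |a|^2 + t^2 |b|^2).\<close>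
  have "P (\<psi> (s + t) (t - s)) \<le> B * Re (\<psi> (s + t) (t - s) 0)"
    and "- P (\<psi> (s - t) (- (s + t))) \<le> B * Re (\<psi> (s - t) (- (s + t)) 0)"
    using pd_fun_bound[OF P(1) pd P(2), of "s + t" "t - s"]
      pd_fun_bound[OF P(1) pd P(2), of "s - t" "- (s + t)"] by linarith+
  then have "P (\<psi> (s + t) (t - s)) - P (\<psi> (s - t) (- (s + t)))
    \<le> B * (Re (\<psi> (s + t) (t - s) 0) + Re (\<psi> (s - t) (- (s + t)) 0))"
    by (simp add: distrib_left)
  also have "Re (\<psi> (s + t) (t - s) 0) + Re (\<psi> (s - t) (- (s + t)) 0)
    = 4 * e"
    unfolding \<psi>0 e_def by (simp add: power2_eq_square field_simps)
  also have "P (\<psi> (s + t) (t - s)) - P (\<psi> (s - t) (- (s + t))) = 4 * (s * t) * (?X - ?Z)"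
    unfolding P\<psi> by (simp add: power2_eq_square algebra_simps)
  finally have "?X - ?Z \<le> B * e" by (simp add: st(1))
  then show ?thesis by (simp only: e_def st(2))
qed

text \<open>Wiener's argument against atoms: \<open>\<Psi>\<close> is the Fejer kernel in the first
  variable, the squared modulus of an average of M characters, and at a c0 function it is an average
  in which large values become rare.\<close>

lemma small_kernel_at_c0:
  fixes \<phi> :: "int \<times> int \<Rightarrow> complex"
  assumes c0: "\<And>\<epsilon>. \<epsilon> > 0 \<Longrightarrow> finite {n. norm (\<phi> n) \<ge> \<epsilon>}" and "\<epsilon> > 0"
  shows "\<exists>\<Psi>. trig_poly \<Psi> \<and> (\<forall>x. \<Psi> (char2 x) \<ge> 0) \<and> \<Psi> (char2 0) = 1 \<and> \<Psi> \<phi> < \<epsilon>"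
proof -
  define S where "S = {n. norm (\<phi> n) \<ge> \<epsilon> / 2}"
  have S: "finite S" unfolding S_def using c0[of "\<epsilon> / 2"] assms(2) by simp
  define b where "b = (\<Sum>n\<in>S. norm (\<phi> n))"
  have b: "b \<ge> 0" by (simp add: b_def sum_nonneg)
  obtain M :: nat where M: "real M > 2 * b / \<epsilon> + 1" using reals_Archimedean2 by blast
  have "2 * b / \<epsilon> \<ge> 0" using b assms(2) by simp
  with M have M0: "M > 0" by (cases M) auto
  have bM: "b / real M < \<epsilon> / 2" using M M0 assms(2) by (simp add: field_simps)
  define \<Psi> where "\<Psi> \<psi> = (1 / real (M\<^sup>2)) * (\<Sum>i<M. \<Sum>j<M. Re (\<psi> (int j - int i, 0)))" for \<psi> :: "int \<times> int \<Rightarrow> complex"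
  have "trig_poly \<Psi>" unfolding \<Psi>_def
    by (intro trig_poly_scale trig_poly_sum trig_poly_Re finite_lessThan)
  moreover have "\<Psi> (char2 x) \<ge> 0" for x
  proof -
    define T where "T = (\<Sum>j<M. char2 x (int j, 0))"
    have "(\<Sum>i<M. \<Sum>j<M. char2 x (int j - int i, 0)) = (\<Sum>i<M. \<Sum>j<M. cnj (char2 x (int i, 0)) * char2 x (int j, 0))"
    proof (intro sum.cong refl)
      fix i j
      have "char2 x ((int j, 0) - (int i, 0)) = char2 x (int j, 0) * cnj (char2 x (int i, 0))" by (rule char2_diff)
      then show "char2 x (int j - int i, 0) = cnj (char2 x (int i, 0)) * char2 x (int j, 0)"
        by (simp add: mult.commute)
    qed
    also have "\<dots> = cnj T * T" by (simp add: T_def sum_product)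
    finally have "(\<Sum>i<M. \<Sum>j<M. Re (char2 x (int j - int i, 0))) = Re (cnj T * T)"
      by (simp flip: Re_sum)
    also have "\<dots> \<ge> 0" by simp
    finally show ?thesis by (simp add: \<Psi>_def)
  qed
  moreover have "\<Psi> (char2 0) = 1" using M0 by (simp add: \<Psi>_def zero_prod_def power2_eq_square)
  moreover have "\<Psi> \<phi> < \<epsilon>"
  proof -
    \<comment> \<open>For fixed i, distinct j give distinct points, so each exceptional point of S
      enters at most once and all of them together contribute at most b.\<close>
    have "(\<Sum>j<M. Re (\<phi> (int j - int i, 0))) \<le> real M * (\<epsilon> / 2) + b" for i
    proof -
      let ?f = "\<lambda>j. (int j - int i, 0::int)"
      have "(\<Sum>j<M. Re (\<phi> (?f j))) \<le> (\<Sum>j<M. \<epsilon> / 2 + (if ?f j \<in> S then norm (\<phi> (?f j)) else 0))"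
      proof (rule sum_mono)
        fix j
        show "Re (\<phi> (?f j)) \<le> \<epsilon> / 2 + (if ?f j \<in> S then norm (\<phi> (?f j)) else 0)"
          using complex_Re_le_cmod[of "\<phi> (?f j)"] assms(2) by (auto simp: S_def)
      qed
      also have "\<dots> = real M * (\<epsilon> / 2) + (\<Sum>j\<in>{j\<in>{..<M}. ?f j \<in> S}. norm (\<phi> (?f j)))"
        by (subst sum.inter_filter) (simp_all add: sum.distrib)
      also have "(\<Sum>j\<in>{j\<in>{..<M}. ?f j \<in> S}. norm (\<phi> (?f j))) = (\<Sum>n\<in>?f ` {j\<in>{..<M}. ?f j \<in> S}. norm (\<phi> n))"
        by (subst sum.reindex) (auto simp: inj_on_def)
      also have "\<dots> \<le> b" unfolding b_def by (intro sum_mono2 S) auto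
      finally show ?thesis by simp
    qed
    then have "(\<Sum>i<M. \<Sum>j<M. Re (\<phi> (int j - int i, 0))) \<le> (\<Sum>i<M. real M * (\<epsilon> / 2) + b)"
      by (rule sum_mono)
    also have "\<dots> = real M * (real M * (\<epsilon> / 2) + b)" by simp
    finally have "\<Psi> \<phi> \<le> (1 / real (M\<^sup>2)) * (real M * (real M * (\<epsilon> / 2) + b))"
      unfolding \<Psi>_def by (intro mult_left_mono) auto
    also have "\<dots> = \<epsilon> / 2 + b / real M" using M0 by (simp add: field_simps power2_eq_square)
    finally show ?thesis using bM by linarith
  qed
  ultimately show ?thesis by blast
qed

text \<open>The choices are made in the order C and C', s, j, \<open>\<Psi>\<close>, then P and P';
  this is possible because \<open>E j\<close> and \<open>D j\<close> do not mention the
  polynomials.\<close>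

lemma (in group) not_haagerup_if_hyperbolic_pair:
  fixes \<iota> :: "int \<times> int \<Rightarrow> 'a"
  assumes \<iota>: "\<And>n. \<iota> n \<in> carrier G" "\<And>m n. \<iota> (m + n) = \<iota> m \<otimes> \<iota> n" "inj \<iota>"
    and g: "g \<in> carrier G" "\<And>n. g \<otimes> \<iota> n = \<iota> (lin a b c d n) \<otimes> g"
    and g': "g' \<in> carrier G" "\<And>n. g' \<otimes> \<iota> n = \<iota> (lin a' b' c' d' n) \<otimes> g'"
    and "l > 1"
    and ev: "is_eigenvector a b c d l u" "is_eigenvector a b c d (1 / l) v"
      "is_eigenvector a' b' c' d' l u'" "is_eigenvector a' b' c' d' (1 / l) v'"
    and indep: "\<forall>y. y \<noteq> 0 \<longrightarrow> (u \<bullet> y) * (v \<bullet> y) \<noteq> 0 \<or> (u' \<bullet> y) * (v' \<bullet> y) \<noteq> 0"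
  shows "\<not> haagerup G"
proof
  assume "haagerup G"
  then obtain \<phi> where \<phi>: "\<And>j. positive_definite G (\<phi> j)" "\<And>j. vanishes_at_infinity G (\<phi> j)"
    "\<And>g. g \<in> carrier G \<Longrightarrow> (\<lambda>j. \<phi> j g) \<longlonglongrightarrow> 1"
    unfolding haagerup_def by blast
  obtain C C' where C: "C > 0" "C' \<ge> 0" and main: "\<And>\<Psi>. trig_poly \<Psi> \<Longrightarrow> (\<forall>x. \<Psi> (char2 x) \<ge> 0) \<Longrightarrow> \<Psi> (char2 0) = 1 \<Longrightarrow>
    (\<exists>P P'. trig_poly P \<and> trig_poly P' \<and> (\<forall>x. \<bar>P (char2 x)\<bar> \<le> 2) \<and> (\<forall>x. \<bar>P' (char2 x)\<bar> \<le> 2) \<and>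
      (\<forall>x. 1/2 \<le> C * ((P (char2 (lin_dual a b c d x)) - P (char2 x))
           + (P' (char2 (lin_dual a' b' c' d' x)) - P' (char2 x)))
         + C' * dist_corner (cis2 x) + 4 * \<Psi> (char2 x)))"
    using two_hyperbolic_inequality[OF \<open>l > 1\<close> ev indep] by (elim exE conjE) (rule that, assumption, assumption, blast)
  \<comment> \<open>In the limit each E equals 2 / s^2 = 1 / (16 C), so both invariance terms
    together cost 1/4 and Q tends to -1/4. This leaves room for the bound 1/8 on
    \<open>4 * \<Psi> \<psi>\<close>.\<close>
  define s where "s = sqrt (32 * C)"
  have s: "s > 0" "s\<^sup>2 = 32 * C" using C by (auto simp: s_def)
  define E where "E j h = s\<^sup>2 * (Re (\<phi> j \<one>) - (Re (\<phi> j h) + Re (\<phi> j (inv h))) / 2)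
        + (1 / s\<^sup>2) * (Re (\<phi> j \<one>) + (Re (\<phi> j h) + Re (\<phi> j (inv h))) / 2)" for j h
  define D where "D j = 2 * Re (\<phi> j \<one>) - Re (\<phi> j (\<iota> (1, 0))) - Re (\<phi> j (\<iota> (0, 1)))" for j
  define Q where "Q j = C * (2 * E j g + 2 * E j g') + C' * D j - 1/2 * Re (\<phi> j \<one>)" for j
  have lim: "(\<lambda>j. Re (\<phi> j h)) \<longlonglongrightarrow> Re 1" if "h \<in> carrier G" for h
    by (intro tendsto_Re \<phi>(3) that)
  have "(\<lambda>j. E j h) \<longlonglongrightarrow> s\<^sup>2 * (Re 1 - (Re 1 + Re 1) / 2) + (1 / s\<^sup>2) * (Re 1 + (Re 1 + Re 1) / 2)"
    if "h \<in> carrier G" for h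
    unfolding E_def using that by (intro tendsto_add tendsto_mult tendsto_diff tendsto_divide tendsto_const lim) auto
  then have limE: "(\<lambda>j. E j h) \<longlonglongrightarrow> 2 / s\<^sup>2" if "h \<in> carrier G" for h
    using that by simp
  have "D \<longlonglongrightarrow> 2 * Re 1 - Re 1 - Re 1"
    unfolding D_def by (intro tendsto_mult tendsto_diff tendsto_const lim \<iota>(1) one_closed)
  then have limD: "D \<longlonglongrightarrow> 0" by simp
  have "Q \<longlonglongrightarrow> C * (2 * (2 / s\<^sup>2) + 2 * (2 / s\<^sup>2)) + C' * 0 - 1/2 * Re 1"
    unfolding Q_def
    by (intro tendsto_add tendsto_mult tendsto_diff tendsto_const lim limE limD g(1) g'(1) one_closed)
  also have "C * (2 * (2 / s\<^sup>2) + 2 * (2 / s\<^sup>2)) + C' * 0 - 1/2 * Re 1 = -1/4"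
    using C(1) unfolding s(2) by (simp add: field_simps)
  finally have "\<forall>\<^sub>F j in sequentially. Q j < -1/8" by (rule order_tendstoD) simp
  then obtain j where j: "Q j < -1/8" by (auto simp: eventually_sequentially)
  have \<iota>0: "\<iota> 0 = \<one>" using \<iota>(1)[of 0] \<iota>(2)[of 0 0] by (metis add.right_neutral l_cancel_one)
  define \<psi> where "\<psi> n = \<phi> j (\<iota> n)" for n
  have pd: "pd_fun \<psi>"
    using pd_fun_vector_state[OF \<phi>(1)[of j] \<iota>(1,2), of "{()}" "\<lambda>_. \<one>" "\<lambda>_. 1"] \<iota>(1) by (simp add: \<psi>_def[abs_def])
  have "finite {n. norm (\<psi> n) \<ge> \<epsilon>}" if "\<epsilon> > 0" for \<epsilon>
  proof -
    have "\<iota> ` {n. norm (\<psi> n) \<ge> \<epsilon>} \<subseteq> {g \<in> carrier G. norm (\<phi> j g) \<ge> \<epsilon>}" by (auto simp: \<psi>_def \<iota>(1))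
    moreover have "finite {g \<in> carrier G. norm (\<phi> j g) \<ge> \<epsilon>}" using \<phi>(2)[of j] that unfolding vanishes_at_infinity_def by blast
    ultimately show ?thesis by (metis finite_imageD finite_subset inj_on_subset \<iota>(3) subset_UNIV)
  qed
  then obtain \<Psi> where \<Psi>: "trig_poly \<Psi>" "\<forall>x. \<Psi> (char2 x) \<ge> 0" "\<Psi> (char2 0) = 1" "\<Psi> \<psi> < 1/32"
    using small_kernel_at_c0[of \<psi> "1/32"] by auto
  obtain P P' where P: "trig_poly P" "\<And>x. \<bar>P (char2 x)\<bar> \<le> 2" and P': "trig_poly P'" "\<And>x. \<bar>P' (char2 x)\<bar> \<le> 2"
    and ineq: "\<And>x. 1/2 \<le> C * ((P (char2 (lin_dual a b c d x)) - P (char2 x))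
           + (P' (char2 (lin_dual a' b' c' d' x)) - P' (char2 x)))
         + C' * dist_corner (cis2 x) + 4 * \<Psi> (char2 x)"
    using main[OF \<Psi>(1-3)] by (elim exE conjE) (rule that, assumption, blast, assumption, blast, blast)
  \<comment> \<open>The torus inequality moved to one side; the constant 1/2 becomes a multiple of
    \<open>Re (\<psi> 0)\<close>, the functional of the constant polynomial.\<close>
  define \<Omega> where "\<Omega> \<psi> = C * ((P (\<lambda>n. \<psi> (lin a b c d n)) - P \<psi>) + (P' (\<lambda>n. \<psi> (lin a' b' c' d' n)) - P' \<psi>))
     + C' * (2 * Re (\<psi> 0) - Re (\<psi> (1, 0)) - Re (\<psi> (0, 1))) + 4 * \<Psi> \<psi> - 1/2 * Re (\<psi> 0)" for \<psi>
  have "trig_poly \<Omega>" unfolding \<Omega>_def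
    by (intro trig_poly.add trig_poly_diff trig_poly_scale trig_poly_Re P(1) P'(1) \<Psi>(1)
        trig_poly_pullback[OF P(1)] trig_poly_pullback[OF P'(1)])
  moreover have "\<Omega> (char2 x) \<ge> 0" for x
  proof -
    have "2 * Re (char2 x 0) - Re (char2 x (1, 0)) - Re (char2 x (0, 1)) = dist_corner (cis2 x)"
      by (simp add: char2_def dist_corner_def)
    then show ?thesis unfolding \<Omega>_def using ineq[of x] by (simp add: char2_lin)
  qed
  ultimately have "\<Omega> \<psi> \<ge> 0" using trig_poly_nonneg[OF _ pd] by blast
  moreover have "P (\<lambda>n. \<psi> (lin a b c d n)) - P \<psi> \<le> 2 * E j g"
    unfolding E_def \<psi>_def[abs_def] by (rule almost_invariance[OF \<phi>(1) \<iota>(1,2) g P s(1)])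
  moreover have "P' (\<lambda>n. \<psi> (lin a' b' c' d' n)) - P' \<psi> \<le> 2 * E j g'"
    unfolding E_def \<psi>_def[abs_def] by (rule almost_invariance[OF \<phi>(1) \<iota>(1,2) g' P' s(1)])
  ultimately have "0 \<le> C * (2 * E j g + 2 * E j g') + C' * (2 * Re (\<psi> 0) - Re (\<psi> (1, 0)) - Re (\<psi> (0, 1)))
     + 4 * \<Psi> \<psi> - 1/2 * Re (\<psi> 0)"
    using C(1) unfolding \<Omega>_def by (smt (verit) mult_left_mono)
  also have "\<dots> = Q j + 4 * \<Psi> \<psi>" by (simp add: Q_def D_def \<psi>_def \<iota>0)
  finally show False using j \<Psi>(4) by linarith
qed

section \<open>The group \<open>\<int>\<^sup>2 \<rtimes> SL\<^sub>2(\<int>)\<close>\<close>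

text \<open>The overlap ratios are coefficients of normalised indicators in the left regular
  representation: the quadratic form is a sum of squares over points y, and the support lies in the
  finite set of quotients of elements of F n.\<close>

lemma haagerup_if_folner:
  fixes G (structure)
  assumes "group G"
    and F: "\<And>n. finite (F n)" "\<And>n. F n \<noteq> {}" "\<And>n. F n \<subseteq> carrier G"
    and folner: "\<And>g. g \<in> carrier G \<Longrightarrow>
      (\<lambda>n::nat. real (card (F n \<inter> (\<lambda>x. g \<otimes> x) ` F n)) / real (card (F n))) \<longlonglongrightarrow> 1"
  shows "haagerup G"
proof -
  interpret group G by fact
  define \<phi> where "\<phi> n g = complex_of_real (real (card (F n \<inter> (\<lambda>x. g \<otimes> x) ` F n)) / real (card (F n)))" for n g
  have "positive_definite G (\<phi> n)" for n
    unfolding positive_definite_def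
  proof (intro allI impI; elim conjE)
    fix S and c :: "'a \<Rightarrow> complex" assume S: "finite S" "S \<subseteq> carrier G"
    define T where "T g = (\<lambda>x. g \<otimes> x) ` F n" for g
    define Y where "Y = (\<Union>g\<in>S. T g)"
    have Y: "finite Y" unfolding Y_def T_def using S F by auto
    \<comment> \<open>Left translation by g carries the overlap that defines \<open>\<phi>\<close>
      to that of the translates by g and h.\<close>
    have eq: "card (F n \<inter> (\<lambda>x. (inv g \<otimes> h) \<otimes> x) ` F n) = card (T g \<inter> T h)" if "g \<in> S" "h \<in> S" for g h
    proof -
      have gh: "g \<in> carrier G" "h \<in> carrier G" using that S by auto
      have Fc: "x \<in> F n \<Longrightarrow> x \<in> carrier G" for x using F by auto
      have "T g \<inter> T h = (\<lambda>x. g \<otimes> x) ` (F n \<inter> (\<lambda>x. (inv g \<otimes> h) \<otimes> x) ` F n)"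
      proof (intro equalityI subsetI)
        fix y assume "y \<in> T g \<inter> T h"
        then obtain a b where "a \<in> F n" "b \<in> F n" "y = g \<otimes> a" "y = h \<otimes> b" unfolding T_def by auto
        moreover from this have "a = inv g \<otimes> h \<otimes> b"
          using gh Fc by (metis inv_closed inv_solve_left m_assoc m_closed)
        ultimately show "y \<in> (\<lambda>x. g \<otimes> x) ` (F n \<inter> (\<lambda>x. (inv g \<otimes> h) \<otimes> x) ` F n)" by auto
      next
        fix y assume "y \<in> (\<lambda>x. g \<otimes> x) ` (F n \<inter> (\<lambda>x. (inv g \<otimes> h) \<otimes> x) ` F n)"
        then obtain a b where ab: "a \<in> F n" "b \<in> F n" "y = g \<otimes> a" "a = inv g \<otimes> h \<otimes> b" by auto
        then have "y = h \<otimes> b" using gh Fc by (simp add: m_assoc[symmetric])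
        then have "y \<in> T h" using ab(2) unfolding T_def by blast
        moreover have "y \<in> T g" using ab(1,3) unfolding T_def by blast
        ultimately show "y \<in> T g \<inter> T h" by blast
      qed
      moreover have "inj_on (\<lambda>x. g \<otimes> x) (F n \<inter> X)" for X
        using gh Fc by (auto intro!: inj_onI)
      ultimately show ?thesis by (simp add: card_image)
    qed
    have double_sum: "(\<Sum>g\<in>S. \<Sum>h\<in>S. cnj (e g) * e h) = of_real ((cmod (\<Sum>g\<in>S. e g))\<^sup>2)" for e
    proof -
      have "(\<Sum>g\<in>S. \<Sum>h\<in>S. cnj (e g) * e h) = (\<Sum>g\<in>S. cnj (e g)) * (\<Sum>h\<in>S. e h)"
        by (simp only: sum_product)
      also have "\<dots> = (\<Sum>g\<in>S. e g) * cnj (\<Sum>g\<in>S. e g)" by (simp add: mult.commute)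
      finally show ?thesis by (simp only: complex_norm_square)
    qed
    have "(\<Sum>g\<in>S. \<Sum>h\<in>S. cnj (c g) * c h * \<phi> n (inv g \<otimes> h))
       = (\<Sum>g\<in>S. \<Sum>h\<in>S. \<Sum>y\<in>Y. cnj (c g * of_bool (y \<in> T g)) * (c h * of_bool (y \<in> T h))) / of_nat (card (F n))"
      unfolding sum_divide_distrib
    proof (intro sum.cong refl)
      fix g h assume gh: "g \<in> S" "h \<in> S"
      have "T g \<inter> T h = {y\<in>Y. y \<in> T g \<and> y \<in> T h}" using gh by (auto simp: Y_def)
      then have "complex_of_nat (card (T g \<inter> T h)) = (\<Sum>y\<in>{y\<in>Y. y \<in> T g \<and> y \<in> T h}. 1)" by simp
      also have "\<dots> = (\<Sum>y\<in>Y. if y \<in> T g \<and> y \<in> T h then 1 else 0)" by (rule sum.inter_filter[OF Y])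
      also have "\<dots> = (\<Sum>y\<in>Y. of_bool (y \<in> T g) * of_bool (y \<in> T h))" by (intro sum.cong) auto
      finally have "complex_of_nat (card (T g \<inter> T h)) = (\<Sum>y\<in>Y. of_bool (y \<in> T g) * of_bool (y \<in> T h))" .
      then have "cnj (c g) * c h * \<phi> n (inv g \<otimes> h)
          = cnj (c g) * c h * (\<Sum>y\<in>Y. of_bool (y \<in> T g) * of_bool (y \<in> T h)) / of_nat (card (F n))"
        unfolding \<phi>_def eq[OF gh] by simp
      also have "cnj (c g) * c h * (\<Sum>y\<in>Y. of_bool (y \<in> T g) * of_bool (y \<in> T h))
          = (\<Sum>y\<in>Y. cnj (c g * of_bool (y \<in> T g)) * (c h * of_bool (y \<in> T h)))"
        unfolding sum_distrib_left by (intro sum.cong refl) simp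
      finally show "cnj (c g) * c h * \<phi> n (inv g \<otimes> h)
          = (\<Sum>y\<in>Y. cnj (c g * of_bool (y \<in> T g)) * (c h * of_bool (y \<in> T h)) / of_nat (card (F n)))"
        by (simp add: sum_divide_distrib)
    qed
    also have "(\<Sum>g\<in>S. \<Sum>h\<in>S. \<Sum>y\<in>Y. cnj (c g * of_bool (y \<in> T g)) * (c h * of_bool (y \<in> T h)))
       = (\<Sum>g\<in>S. \<Sum>y\<in>Y. \<Sum>h\<in>S. cnj (c g * of_bool (y \<in> T g)) * (c h * of_bool (y \<in> T h)))"
      by (intro sum.cong refl sum.swap)
    also have "\<dots> = (\<Sum>y\<in>Y. \<Sum>g\<in>S. \<Sum>h\<in>S. cnj (c g * of_bool (y \<in> T g)) * (c h * of_bool (y \<in> T h)))"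
      by (rule sum.swap)
    also have "\<dots> = (\<Sum>y\<in>Y. of_real ((cmod (\<Sum>g\<in>S. c g * of_bool (y \<in> T g)))\<^sup>2))"
      by (intro sum.cong refl double_sum)
    also have "\<dots> / of_nat (card (F n)) = of_real ((\<Sum>y\<in>Y. (cmod (\<Sum>g\<in>S. c g * of_bool (y \<in> T g)))\<^sup>2) / real (card (F n)))"
      by simp
    also have "\<dots> \<in> \<real>\<^sub>\<ge>\<^sub>0"
      by (subst nonneg_Reals_of_real_iff) (intro divide_nonneg_nonneg sum_nonneg, auto)
    finally show "(\<Sum>g\<in>S. \<Sum>h\<in>S. cnj (c g) * c h * \<phi> n (inv g \<otimes> h)) \<in> \<real>\<^sub>\<ge>\<^sub>0" .
  qed
  moreover have "vanishes_at_infinity G (\<phi> n)" for n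
    unfolding vanishes_at_infinity_def
  proof (intro allI impI)
    fix \<epsilon> :: real assume "\<epsilon> > 0"
    have "{g \<in> carrier G. norm (\<phi> n g) \<ge> \<epsilon>} \<subseteq> (\<lambda>(x, y). x \<otimes> inv y) ` (F n \<times> F n)"
    proof
      fix g assume g: "g \<in> {g \<in> carrier G. norm (\<phi> n g) \<ge> \<epsilon>}"
      then have "F n \<inter> (\<lambda>x. g \<otimes> x) ` F n \<noteq> {}" using \<open>\<epsilon> > 0\<close> unfolding \<phi>_def by force
      then obtain x y where xy: "x \<in> F n" "y \<in> F n" "x = g \<otimes> y" by auto
      then have "g = x \<otimes> inv y" using g F by (metis (no_types, lifting) mem_Collect_eq subsetD inv_solve_right m_closed)
      with xy(1,2) show "g \<in> (\<lambda>(x, y). x \<otimes> inv y) ` (F n \<times> F n)"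
        by (intro image_eqI[of _ _ "(x, y)"]) simp_all
    qed
    then show "finite {g \<in> carrier G. norm (\<phi> n g) \<ge> \<epsilon>}" by (rule finite_subset) (use F in auto)
  qed
  moreover have "(\<lambda>n. \<phi> n g) \<longlonglongrightarrow> 1" if "g \<in> carrier G" for g
    using tendsto_of_real[OF folner[OF that], where 'a = complex] by (simp add: \<phi>_def)
  ultimately show ?thesis unfolding haagerup_def by blast
qed

lemma group_semidirect_product:
  assumes "group N" "group H"
    and hom: "\<And>h. h \<in> carrier H \<Longrightarrow> \<alpha> h \<in> hom N N"
    and act: "\<And>g h n. g \<in> carrier H \<Longrightarrow> h \<in> carrier H \<Longrightarrow> n \<in> carrier N \<Longrightarrow> \<alpha> (g \<otimes>\<^bsub>H\<^esub> h) n = \<alpha> g (\<alpha> h n)"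
      "\<And>n. n \<in> carrier N \<Longrightarrow> \<alpha> \<one>\<^bsub>H\<^esub> n = n"
  shows "group (semidirect_product N H \<alpha>)"
proof -
  interpret N: group N by fact
  interpret H: group H by fact
  have cl: "\<alpha> h n \<in> carrier N" if "h \<in> carrier H" "n \<in> carrier N" for h n
    using hom[OF that(1)] that(2) by (auto simp: hom_def)
  have mult: "\<alpha> h (m \<otimes>\<^bsub>N\<^esub> n) = \<alpha> h m \<otimes>\<^bsub>N\<^esub> \<alpha> h n" if "h \<in> carrier H" "m \<in> carrier N" "n \<in> carrier N" for h m n
    using hom[OF that(1)] that by (auto simp: hom_def)
  have one: "\<alpha> h \<one>\<^bsub>N\<^esub> = \<one>\<^bsub>N\<^esub>" if "h \<in> carrier H" for h
    using hom[OF that] hom_one[OF _ assms(1) assms(1)] by blast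
  show ?thesis
  proof (rule groupI)
    fix x assume "x \<in> carrier (semidirect_product N H \<alpha>)"
    then obtain n h where x: "x = (n, h)" "n \<in> carrier N" "h \<in> carrier H" by (auto simp: semidirect_product_def)
    then show "\<exists>y\<in>carrier (semidirect_product N H \<alpha>).
       y \<otimes>\<^bsub>semidirect_product N H \<alpha>\<^esub> x = \<one>\<^bsub>semidirect_product N H \<alpha>\<^esub>"
      using mult[of "inv\<^bsub>H\<^esub> h" "inv\<^bsub>N\<^esub> n" n] one[of "inv\<^bsub>H\<^esub> h"]
      by (intro bexI[of _ "(\<alpha> (inv\<^bsub>H\<^esub> h) (inv\<^bsub>N\<^esub> n), inv\<^bsub>H\<^esub> h)"]) (auto simp: semidirect_product_def cl)
  qed (auto simp: semidirect_product_def cl mult act N.m_assoc H.m_assoc)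
qed

section \<open>Coordinates for integer matrices and the groups built from them\<close>

definition mat2 :: "int \<Rightarrow> int \<Rightarrow> int \<Rightarrow> int \<Rightarrow> int ^ 2 ^ 2" where
  "mat2 a b c d = vector [vector [a, b], vector [c, d]]"

definition vec2 :: "int \<Rightarrow> int \<Rightarrow> int ^ 2" where
  "vec2 m n = vector [m, n]"

lemma mat2_nth [simp]: "mat2 a b c d $ 1 $ 1 = a" "mat2 a b c d $ 1 $ 2 = b"
   "mat2 a b c d $ 2 $ 1 = c" "mat2 a b c d $ 2 $ 2 = d"
  by (simp_all add: mat2_def vector_2)

lemma vec2_nth [simp]: "vec2 m n $ 1 = m" "vec2 m n $ 2 = n"
  by (simp_all add: vec2_def vector_2)

lemma mat2_eta: "A = mat2 (A $ 1 $ 1) (A $ 1 $ 2) (A $ 2 $ 1) (A $ 2 $ 2)"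
  by (simp add: vec_eq_iff forall_2)

lemma vec2_eta: "v = vec2 (v $ 1) (v $ 2)"
  by (simp add: vec_eq_iff forall_2)

lemma mat2_mult: "mat2 a b c d ** mat2 a' b' c' d'
    = mat2 (a * a' + b * c') (a * b' + b * d') (c * a' + d * c') (c * b' + d * d')"
  by (simp add: vec_eq_iff forall_2 matrix_matrix_mult_def sum_2)

lemma mat2_mult_vec2: "mat2 a b c d *v vec2 m n = vec2 (a * m + b * n) (c * m + d * n)"
  by (simp add: vec_eq_iff forall_2 matrix_vector_mult_def sum_2)

lemma vec2_add: "vec2 m n + vec2 m' n' = vec2 (m + m') (n + n')"
  by (simp add: vec_eq_iff forall_2)

lemma vec2_inject [simp]: "vec2 m n = vec2 m' n' \<longleftrightarrow> m = m' \<and> n = n'"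
  by (auto simp: vec_eq_iff forall_2)

lemma det_mat2: "det (mat2 a b c d) = a * d - b * c"
  by (simp add: det_2)

lemma mat_1_mat2: "mat 1 = mat2 1 0 0 1"
  by (simp add: vec_eq_iff forall_2 mat_def)

lemma group_SL2Z: "group SL2Z"
proof (rule groupI)
  fix A assume A: "A \<in> carrier SL2Z"
  define B where "B = mat2 (A $ 2 $ 2) (- A $ 1 $ 2) (- A $ 2 $ 1) (A $ 1 $ 1)"
  have "det B = 1" "B ** A = mat 1"
    using A by (simp_all add: B_def SL2Z_def det_2 vec_eq_iff forall_2 matrix_matrix_mult_def sum_2 mat_def algebra_simps)
  then show "\<exists>B\<in>carrier SL2Z. B \<otimes>\<^bsub>SL2Z\<^esub> A = \<one>\<^bsub>SL2Z\<^esub>" by (auto simp: SL2Z_def)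
qed (auto simp: SL2Z_def det_mul matrix_mul_assoc)

lemma group_Z2: "group Z2"
  by (rule groupI) (auto simp: Z2_def algebra_simps intro: exI[of _ "- _"])

abbreviation Z2_SL2Z :: "((int ^ 2) \<times> (int ^ 2 ^ 2)) monoid" where
  "Z2_SL2Z \<equiv> semidirect_product Z2 SL2Z (\<lambda>A v. A *v v)"

lemma group_Z2_SL2Z: "group Z2_SL2Z"
  by (rule group_semidirect_product[OF group_Z2 group_SL2Z])
     (auto simp: hom_def Z2_def SL2Z_def matrix_vector_right_distrib matrix_vector_mul_assoc)

lemma Z2_SL2Z_simps:
  "carrier Z2_SL2Z = UNIV \<times> {A. det A = 1}"
  "(v, A) \<otimes>\<^bsub>Z2_SL2Z\<^esub> (w, B) = (v + A *v w, A ** B)"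
  "\<one>\<^bsub>Z2_SL2Z\<^esub> = (0, mat 1)"
  by (simp_all add: semidirect_product_def Z2_def SL2Z_def)

lemma neg_matrix_mult: "(- mat 1) ** A = - A" "A ** (- mat 1) = - A" "(- mat 1) *v v = - v"
  "(- A) ** B = - (A ** B)" "A *v (- v) = - (A *v v)"
  for A B :: "int ^ 2 ^ 2" and v :: "int ^ 2"
  by (simp_all add: vec_eq_iff forall_2 matrix_matrix_mult_def matrix_vector_mult_def sum_2 mat_def)

lemma mat_1_neq_neg: "mat 1 \<noteq> (- mat 1 :: int ^ 2 ^ 2)"
  by (simp add: vec_eq_iff forall_2 mat_def)

lemma det_neg_mat_1: "det (- mat 1 :: int ^ 2 ^ 2) = 1"
  by (simp add: det_2 mat_def)

lemma subgroup_center_SL2Z: "subgroup {mat 1, - mat 1} SL2Z"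
proof -
  have "inv\<^bsub>SL2Z\<^esub> (- mat 1) = - mat 1"
    by (rule group.inv_equality[OF group_SL2Z]) (auto simp: SL2Z_def neg_matrix_mult det_neg_mat_1)
  moreover have "inv\<^bsub>SL2Z\<^esub> (mat 1) = mat 1"
    using group.is_monoid[OF group_SL2Z, THEN monoid.inv_one] by (simp add: SL2Z_def)
  ultimately show ?thesis
    by (intro group.subgroupI[OF group_SL2Z]) (auto simp: SL2Z_def neg_matrix_mult det_neg_mat_1)
qed

lemma generate_neg_mat_1: "generate SL2Z {- mat 1} = {mat 1, - mat 1}"
proof
  show "generate SL2Z {- mat 1} \<subseteq> {mat 1, - mat 1}"
    by (rule group.generate_subgroup_incl[OF group_SL2Z _ subgroup_center_SL2Z]) simp
  show "{mat 1, - mat 1} \<subseteq> generate SL2Z {- mat 1}"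
    using generate.one[of SL2Z "{- mat 1}"] generate.incl[of "- mat 1" "{- mat 1}" SL2Z] by (auto simp: SL2Z_def)
qed

lemma center_iso: "SL2Z\<lparr>carrier := {mat 1, - mat 1}\<rparr> \<cong> integer_mod_group 2"
proof -
  have "(\<lambda>A. if A = mat 1 then 0 else 1) \<in> iso (SL2Z\<lparr>carrier := {mat 1, - mat 1}\<rparr>) (integer_mod_group 2)"
    using mat_1_neq_neg
    by (auto simp: iso_def hom_def bij_betw_def inj_on_def carrier_integer_mod_group SL2Z_def neg_matrix_mult)
  then show ?thesis by (auto simp: is_iso_def)
qed

abbreviation Z2_center :: "((int ^ 2) \<times> (int ^ 2 ^ 2)) set" where
  "Z2_center \<equiv> UNIV \<times> {mat 1, - mat 1}"

text \<open>The negative identity is central, so conjugation preserves the matrix part, and the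
  translation part is unrestricted.\<close>

lemma Z2_center_normal: "Z2_center \<lhd> Z2_SL2Z"
proof -
  interpret group Z2_SL2Z by (rule group_Z2_SL2Z)
  have conj: "x \<otimes>\<^bsub>Z2_SL2Z\<^esub> h \<otimes>\<^bsub>Z2_SL2Z\<^esub> inv\<^bsub>Z2_SL2Z\<^esub> x \<in> Z2_center"
    if x: "x \<in> carrier Z2_SL2Z" and h: "h \<in> Z2_center" for x h
  proof -
    obtain v A w B where xh: "x = (v, A)" "h = (w, B)" by fastforce
    obtain v' A' where inv: "inv\<^bsub>Z2_SL2Z\<^esub> x = (v', A')" by fastforce
    have "A ** A' = mat 1" using r_inv[OF x] unfolding inv unfolding xh by (simp add: Z2_SL2Z_simps)
    then show ?thesis
      using h inv[unfolded xh(1)] unfolding xh by (auto simp: Z2_SL2Z_simps neg_matrix_mult)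
  qed
  have "subgroup Z2_center Z2_SL2Z"
  proof (rule subgroupI)
    fix a assume a: "a \<in> Z2_center"
    obtain v A where a': "a = (v, A)" by fastforce
    \<comment> \<open>A is plus or minus the identity, hence its own inverse.\<close>
    have "(- (A *v v), A) \<in> carrier Z2_SL2Z" "(- (A *v v), A) \<otimes>\<^bsub>Z2_SL2Z\<^esub> a = \<one>\<^bsub>Z2_SL2Z\<^esub>" "a \<in> carrier Z2_SL2Z"
      using a det_neg_mat_1 by (auto simp: a' Z2_SL2Z_simps neg_matrix_mult)
    then have "inv\<^bsub>Z2_SL2Z\<^esub> a = (- (A *v v), A)" by (intro inv_equality)
    then show "inv\<^bsub>Z2_SL2Z\<^esub> a \<in> Z2_center" using a by (auto simp: a')
  qed (use det_neg_mat_1 in \<open>auto simp: Z2_SL2Z_simps neg_matrix_mult\<close>)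
  then show ?thesis unfolding normal_inv_iff using conj by blast
qed

text \<open>Boxes centred at 0 are invariant under negation, so translating F n by (w, B) merely
  shifts the box by w, and the Folner ratio is that of boxes in Z^2.\<close>

lemma Z2_center_haagerup: "haagerup (Z2_SL2Z\<lparr>carrier := Z2_center\<rparr>)"
proof -
  interpret group Z2_SL2Z by (rule group_Z2_SL2Z)
  let ?K = "Z2_SL2Z\<lparr>carrier := Z2_center\<rparr>"
  have K: "group ?K" by (metis Z2_center_normal normal_imp_subgroup subgroup_imp_group)
  define Box where "Box n = {v :: int ^ 2. \<bar>v $ 1\<bar> \<le> int n \<and> \<bar>v $ 2\<bar> \<le> int n}" for n
  define F where "F n = Box n \<times> {mat 1, - mat 1 :: int ^ 2 ^ 2}" for n
  \<comment> \<open>Shifting by n identifies the centred box with a square of side 2n + 1 starting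
    at 0, to which the earlier pair count applies.\<close>
  have card_Box: "finite {v \<in> Box n. v - w \<in> Box n} \<and>
      card {v \<in> Box n. v - w \<in> Box n} = nat (int (2 * n + 1) - \<bar>w $ 1\<bar>) * nat (int (2 * n + 1) - \<bar>w $ 2\<bar>)" for n w
  proof -
    define B where "B = {0..<int (2 * n + 1)} \<times> {0..<int (2 * n + 1)}"
    let ?P = "{(g, h). g \<in> B \<and> h \<in> B \<and> h - g = (w $ 1, w $ 2)}"
    let ?f = "\<lambda>(g :: int \<times> int, h). vec2 (fst h - int n) (snd h - int n)"
    have "{v \<in> Box n. v - w \<in> Box n} = ?f ` ?P"
    proof (intro equalityI subsetI)
      fix v assume v: "v \<in> {v \<in> Box n. v - w \<in> Box n}"
      let ?h = "(v $ 1 + int n, v $ 2 + int n)"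
      have "(?h - (w $ 1, w $ 2), ?h) \<in> ?P" using v by (auto simp: B_def Box_def)
      moreover have "v = ?f (?h - (w $ 1, w $ 2), ?h)" by (simp add: vec2_eta[symmetric])
      ultimately show "v \<in> ?f ` ?P" by (rule rev_image_eqI)
    qed (auto simp: B_def Box_def)
    moreover have "inj_on ?f ?P" by (auto simp: inj_on_def)
    moreover have "finite ?P" by (rule finite_subset[of _ "B \<times> B"]) (auto simp: B_def)
    moreover have "card ?P = nat (int (2 * n + 1) - \<bar>w $ 1\<bar>) * nat (int (2 * n + 1) - \<bar>w $ 2\<bar>)"
      unfolding B_def by (subst card_shifted_pairs2) simp
    ultimately show ?thesis by (simp add: card_image)
  qed
  have finF: "finite (F n)" for n using card_Box[of n 0] by (simp add: F_def)
  have cardF: "card (F n) = (2 * n + 1) * (2 * n + 1) * 2" for n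
    using card_Box[of n 0] mat_1_neq_neg
    by (simp add: F_def card_cartesian_product del: of_nat_add of_nat_mult of_nat_Suc)
  show ?thesis
  proof (rule haagerup_if_folner[OF K, of F])
    show "finite (F n)" for n by (rule finF)
    show "F n \<noteq> {}" for n using cardF[of n] by auto
    show "F n \<subseteq> carrier ?K" for n by (auto simp: F_def)
    fix g assume "g \<in> carrier ?K"
    then obtain w B where g: "g = (w, B)" "B \<in> {mat 1, - mat 1}" by auto
    have "F n \<inter> (\<lambda>x. g \<otimes>\<^bsub>?K\<^esub> x) ` F n = {v \<in> Box n. v - w \<in> Box n} \<times> {mat 1, - mat 1}" for n
    proof (intro equalityI subsetI)
      fix x assume "x \<in> F n \<inter> (\<lambda>x. g \<otimes>\<^bsub>?K\<^esub> x) ` F n"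
      then show "x \<in> {v \<in> Box n. v - w \<in> Box n} \<times> {mat 1, - mat 1}"
        using g by (auto simp: F_def Z2_SL2Z_simps neg_matrix_mult Box_def)
    next
      fix x :: "(int ^ 2) \<times> (int ^ 2 ^ 2)" assume "x \<in> {v \<in> Box n. v - w \<in> Box n} \<times> {mat 1, - mat 1}"
      then obtain v C where x: "x = (v, C)" "v \<in> Box n" "v - w \<in> Box n" "C \<in> {mat 1, - mat 1}" by auto
      have "x = g \<otimes>\<^bsub>?K\<^esub> (B *v (v - w), B ** C)" using g x by (auto simp: Z2_SL2Z_simps neg_matrix_mult)
      moreover have "(B *v (v - w), B ** C) \<in> F n" using g x by (auto simp: F_def Box_def neg_matrix_mult)
      moreover have "x \<in> F n" using x by (simp add: F_def)
      ultimately show "x \<in> F n \<inter> (\<lambda>x. g \<otimes>\<^bsub>?K\<^esub> x) ` F n" by blast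
    qed
    then have "card (F n \<inter> (\<lambda>x. g \<otimes>\<^bsub>?K\<^esub> x) ` F n)
      = nat (int (2 * n + 1) - \<bar>w $ 1\<bar>) * nat (int (2 * n + 1) - \<bar>w $ 2\<bar>) * 2" for n
      using card_Box[of n w] mat_1_neq_neg by (simp add: card_cartesian_product)
    moreover have "real (x * y * 2) / real (m * m * 2) = real x / real m * (real y / real m)" for x y m :: nat
      by simp
    ultimately have ratio: "real (card (F n \<inter> (\<lambda>x. g \<otimes>\<^bsub>?K\<^esub> x) ` F n)) / real (card (F n))
      = real (nat (int (2 * n + 1) - \<bar>w $ 1\<bar>)) / real (2 * n + 1) * (real (nat (int (2 * n + 1) - \<bar>w $ 2\<bar>)) / real (2 * n + 1))" for n
      by (simp only: cardF)
    have lim: "(\<lambda>n. real (nat (int (2 * n + 1) - \<bar>d\<bar>)) / real (2 * n + 1)) \<longlonglongrightarrow> 1" for d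
      using LIMSEQ_subseq_LIMSEQ[OF tendsto_fejer_factor[of d], of "\<lambda>n. 2 * n + 1"]
      by (simp add: o_def strict_mono_def)
    show "(\<lambda>n. real (card (F n \<inter> (\<lambda>x. g \<otimes>\<^bsub>?K\<^esub> x) ` F n)) / real (card (F n))) \<longlonglongrightarrow> 1"
      unfolding ratio using tendsto_mult[OF lim[of "w $ 1"] lim[of "w $ 2"]] by (simp only: mult_1)
  qed
qed

section \<open>Normal subgroups\<close>

definition adj2 :: "int ^ 2 ^ 2 \<Rightarrow> int ^ 2 ^ 2" where
  "adj2 A = mat2 (A $ 2 $ 2) (- A $ 1 $ 2) (- A $ 2 $ 1) (A $ 1 $ 1)"

lemma adj2_mat2 [simp]: "adj2 (mat2 a b c d) = mat2 d (- b) (- c) a"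
  by (simp add: adj2_def)

lemma adj2_inverse:
  assumes "det A = 1"
  shows "det (adj2 A) = 1" "adj2 A ** A = mat 1" "A ** adj2 A = mat 1"
  using assms
  by (simp_all add: adj2_def det_2 vec_eq_iff forall_2 matrix_matrix_mult_def sum_2 mat_def algebra_simps)

lemma inv_Z2_SL2Z:
  assumes "det A = 1"
  shows "inv\<^bsub>Z2_SL2Z\<^esub> (v, A) = (- (adj2 A *v v), adj2 A)"
  by (rule group.inv_equality[OF group_Z2_SL2Z])
     (use assms adj2_inverse[OF assms] in \<open>auto simp: Z2_SL2Z_simps\<close>)

text \<open>The translation parts stay existential because the conjugation action on Z^2 sees only
  the matrix part.\<close>

lemma normal_subgroup_commutator:
  assumes "N \<lhd> Z2_SL2Z" "(v, A) \<in> N" "det B = 1"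
  shows "\<exists>w. (w, B ** A ** adj2 B ** adj2 A) \<in> N" "\<exists>w. (w, B ** A ** adj2 B) \<in> N"
proof -
  interpret normal N Z2_SL2Z by fact
  note m_closed = subgroup.m_closed[OF subgroup_axioms]
  have A: "det A = 1" using subset assms(2) by (auto simp: Z2_SL2Z_simps)
  have B: "(0, B) \<in> carrier Z2_SL2Z" using assms(3) by (simp add: Z2_SL2Z_simps)
  obtain w where w: "(w, B ** A ** adj2 B) \<in> N"
    using inv_op_closed2[OF B assms(2)] by (auto simp: inv_Z2_SL2Z[OF assms(3)] Z2_SL2Z_simps)
  then show "\<exists>w. (w, B ** A ** adj2 B) \<in> N" by blast
  show "\<exists>w. (w, B ** A ** adj2 B ** adj2 A) \<in> N"
    using m_closed[OF w m_inv_closed[OF assms(2)]] by (auto simp: inv_Z2_SL2Z[OF A] Z2_SL2Z_simps)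
qed

text \<open>The commutator of a matrix with the elementary matrix \<open>mat2 1 1 0 1\<close> has trace \<open>2 + c\<^sup>2\<close>.\<close>

lemma normal_subgroup_hyperbolic:
  assumes N: "N \<lhd> Z2_SL2Z" and vA: "(v, A) \<in> N" "A \<noteq> mat 1" "A \<noteq> - mat 1"
  shows "\<exists>w a b c d. (w, mat2 a b c d) \<in> N \<and> a * d - b * c = 1 \<and> a + d \<ge> 3"
proof -
  interpret normal N Z2_SL2Z by fact
  obtain a b c d where A: "A = mat2 a b c d" using mat2_eta by metis
  have det: "a * d - b * c = 1" using subset vA(1) by (auto simp: Z2_SL2Z_simps A det_mat2)
  \<comment> \<open>A diagonal integer matrix of determinant 1 is plus or minus the
    identity.\<close>
  have "b \<noteq> 0 \<or> c \<noteq> 0"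
  proof (rule ccontr)
    assume "\<not> (b \<noteq> 0 \<or> c \<noteq> 0)"
    moreover from this have "a = 1 \<and> d = 1 \<or> a = -1 \<and> d = -1" using det by (simp add: zmult_eq_1_iff)
    ultimately show False using vA(2,3) by (auto simp: A vec_eq_iff forall_2 mat_def)
  qed
  then show ?thesis
  proof
    assume "c \<noteq> 0"
    then have sq: "c * c \<ge> 1"
      by (metis int_one_le_iff_zero_less zero_less_mult_iff linorder_neqE_linordered_idom)
    let ?p = "(a + c) * d - c * (b + d - a - c)" and ?q = "- ((a + c) * b) + a * (b + d - a - c)"
      and ?r = "c * d - c * (d - c)" and ?s = "a * (d - c) - c * b"
    obtain w where "(w, mat2 1 1 0 1 ** A ** adj2 (mat2 1 1 0 1) ** adj2 A) \<in> N"
      using normal_subgroup_commutator(1)[OF N vA(1), of "mat2 1 1 0 1"] by (auto simp: det_mat2)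
    then have "(w, mat2 ?p ?q ?r ?s) \<in> N" by (simp add: A mat2_mult algebra_simps)
    moreover have "?p * ?s - ?q * ?r = (a * d - b * c) * (a * d - b * c)" by (simp add: algebra_simps)
    then have "?p * ?s - ?q * ?r = 1" unfolding det by simp
    moreover have "?p + ?s = 2 * (a * d - b * c) + c * c" by (simp add: algebra_simps)
    then have "?p + ?s \<ge> 3" unfolding det using sq by linarith
    ultimately show ?thesis by (intro exI conjI)
  next
    \<comment> \<open>The transposed elementary matrix is used here; the trace becomes 2 +
      b^2.\<close>
    assume "b \<noteq> 0"
    then have sq: "b * b \<ge> 1"
      by (metis int_one_le_iff_zero_less zero_less_mult_iff linorder_neqE_linordered_idom)
    let ?p = "(a - b) * d - b * c" and ?q = "- ((a - b) * b) + b * a"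
      and ?r = "(a + c - b - d) * d - (b + d) * c" and ?s = "- ((a + c - b - d) * b) + (b + d) * a"
    obtain w where "(w, mat2 1 0 1 1 ** A ** adj2 (mat2 1 0 1 1) ** adj2 A) \<in> N"
      using normal_subgroup_commutator(1)[OF N vA(1), of "mat2 1 0 1 1"] by (auto simp: det_mat2)
    then have "(w, mat2 ?p ?q ?r ?s) \<in> N" by (simp add: A mat2_mult algebra_simps)
    moreover have "?p * ?s - ?q * ?r = (a * d - b * c) * (a * d - b * c)" by (simp add: algebra_simps)
    then have "?p * ?s - ?q * ?r = 1" unfolding det by simp
    moreover have "?p + ?s = 2 * (a * d - b * c) + b * b" by (simp add: algebra_simps)
    then have "?p + ?s \<ge> 3" unfolding det using sq by linarith
    ultimately show ?thesis by (intro exI conjI)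
  qed
qed

text \<open>Commutators of translations w with (v, A) are the translations w - A w, not all zero
  since A is not the identity. The translations in N form a group invariant under all of SL2(Z),
  which spreads one nonzero vector to a full multiple of Z^2.\<close>

lemma normal_subgroup_lattice:
  assumes N: "N \<lhd> Z2_SL2Z" and vA: "(v, A) \<in> N" "A \<noteq> mat 1"
  shows "\<exists>k. k \<noteq> 0 \<and> (\<forall>m n. (vec2 (k * m) (k * n), mat 1) \<in> N)"
proof -
  interpret normal N Z2_SL2Z by fact
  note m_closed = subgroup.m_closed[OF subgroup_axioms]
    and one_closed = subgroup.one_closed[OF subgroup_axioms]
  have detA: "det A = 1" using subset vA(1) by (auto simp: Z2_SL2Z_simps)
  define L where "L w \<longleftrightarrow> (w, mat 1) \<in> N" for w
  have add: "L (w + w')" if "L w" "L w'" for w w'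
    using m_closed[of "(w, mat 1)" "(w', mat 1)"] that by (simp add: L_def Z2_SL2Z_simps)
  have neg: "L (- w)" if "L w" for w
    using m_inv_closed[of "(w, mat 1)"] that
    by (simp add: L_def inv_Z2_SL2Z adj2_inverse(2)[of "mat 1", simplified])
  have zero: "L 0" using one_closed by (simp add: L_def Z2_SL2Z_simps)
  have act: "L (B *v w)" if "L w" "det B = 1" for w B
    using inv_op_closed2[of "(0, B)" "(w, mat 1)"] that adj2_inverse[OF that(2)]
    by (simp add: L_def inv_Z2_SL2Z Z2_SL2Z_simps)
  have nat_scale: "L (vec2 (int n * p) (int n * q))" if "L (vec2 p q)" for p q n
  proof (induction n)
    case 0
    have "vec2 0 0 = 0" by (simp add: vec_eq_iff forall_2)
    then show ?case using zero by simp
  next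
    case (Suc n)
    then show ?case using add[OF that Suc] by (simp add: vec2_add algebra_simps)
  qed
  have scale: "L (vec2 (m * p) (m * q))" if "L (vec2 p q)" for p q m
  proof (cases m rule: int_cases2)
    case (nonneg n)
    then show ?thesis using nat_scale[OF that] by simp
  next
    case (nonpos n)
    moreover have "- vec2 (int n * p) (int n * q) = vec2 (m * p) (m * q)"
      using nonpos by (simp add: vec_eq_iff forall_2)
    ultimately show ?thesis using neg[OF nat_scale[OF that, of n]] by simp
  qed
  have diff: "L (w - A *v w)" for w
  proof -
    have "(w, mat 1) \<in> carrier Z2_SL2Z" by (simp add: Z2_SL2Z_simps)
    from inv_op_closed2[OF this vA(1)] have "(w + v - A *v w, A) \<in> N"
      by (simp add: inv_Z2_SL2Z adj2_inverse(2)[of "mat 1", simplified] Z2_SL2Z_simps neg_matrix_mult)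
    from m_closed[OF this m_inv_closed[OF vA(1)]] show ?thesis
      using adj2_inverse[OF detA]
      by (simp add: L_def inv_Z2_SL2Z[OF detA] Z2_SL2Z_simps matrix_vector_mul_assoc neg_matrix_mult)
  qed
  obtain a b c d where A: "A = mat2 a b c d" using mat2_eta by metis
  have "vec2 1 0 - A *v vec2 1 0 = vec2 (1 - a) (- c)" "vec2 0 1 - A *v vec2 0 1 = vec2 (- b) (1 - d)"
    by (simp_all add: A mat2_mult_vec2) (simp_all add: vec_eq_iff forall_2)
  then have "L (vec2 (1 - a) (- c))" "L (vec2 (- b) (1 - d))"
    using diff[of "vec2 1 0"] diff[of "vec2 0 1"] by simp_all
  moreover have "1 - a \<noteq> 0 \<or> - c \<noteq> 0 \<or> - b \<noteq> 0 \<or> 1 - d \<noteq> 0"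
    using vA(2) unfolding A mat_1_mat2 by auto
  ultimately obtain p q where pq: "L (vec2 p q)" "p \<noteq> 0 \<or> q \<noteq> 0" by blast
  have "\<exists>k. k \<noteq> 0 \<and> L (vec2 k 0)"
  proof (cases "q = 0")
    case False
    \<comment> \<open>A shear minus the identity maps (p, q) to (q, 0); later a quarter turn gives
      the other axis.\<close>
    have "L (mat2 1 1 0 1 *v vec2 p q + - vec2 p q)"
      using act[OF pq(1), of "mat2 1 1 0 1"] neg[OF pq(1)] by (intro add) (simp_all add: det_mat2)
    moreover have "mat2 1 1 0 1 *v vec2 p q + - vec2 p q = vec2 q 0"
      by (simp add: mat2_mult_vec2) (simp add: vec_eq_iff forall_2)
    ultimately show ?thesis using False by auto
  qed (use pq in auto)
  then obtain k where k: "k \<noteq> 0" "L (vec2 k 0)" by blast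
  have "L (vec2 0 k)" using act[OF k(2), of "mat2 0 (-1) 1 0"] by (simp add: det_mat2 mat2_mult_vec2)
  have "L (vec2 (k * m) (k * n))" for m n
    using add[OF scale[OF k(2), of m] scale[OF \<open>L (vec2 0 k)\<close>, of n]] by (simp add: vec2_add mult.commute)
  then show ?thesis using k(1) unfolding L_def by blast
qed

text \<open>The first row holds identically, and the second is the characteristic equation l^2 - (a
  + d) l + 1 = 0, which 1 / l satisfies as well.\<close>

lemma eigenvector_formula:
  assumes "a * d - b * c = 1" "l \<noteq> 0" "l + 1 / l = of_int (a + d)"
  shows "is_eigenvector a b c d l (of_int b, l - of_int a)"
proof -
  have "l * l + 1 = of_int (a + d) * l" using assms(2,3) by (simp add: field_simps)
  moreover have "real_of_int (a * d - b * c) = 1" using assms(1) by simp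
  then have "of_int c * of_int b = of_int a * of_int d - (1::real)" by (simp add: mult.commute)
  ultimately show ?thesis unfolding is_eigenvector_def by (simp add: algebra_simps)
qed

lemma hyperbolic_eigenvalue:
  fixes t :: real
  assumes "t \<ge> 3"
  shows "\<exists>l>1. l + 1 / l = t"
proof -
  define s where "s = sqrt (t\<^sup>2 - 4)"
  have t2: "t\<^sup>2 \<ge> 9" using power_mono[OF assms, of 2] by simp
  then have s: "s\<^sup>2 = t\<^sup>2 - 4" "s \<ge> 0" by (auto simp: s_def)
  define l where "l = (t + s) / 2"
  have l: "l > 1" using assms s by (simp add: l_def)
  have "l * l + 1 = t * l" using s(1) by (simp add: l_def power2_eq_square field_simps)
  then have "l + 1 / l = t" using l by (simp add: field_simps)
  with l show ?thesis by blast
qed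

lemma no_common_zero:
  fixes y :: "real \<times> real"
  assumes "b \<noteq> 0" "s \<noteq> t" "(b, s) \<bullet> y = 0" "(b, t) \<bullet> y = 0"
  shows "y = 0"
proof -
  have "s * snd y = t * snd y" using assms(3,4)
    unfolding inner_prod_def fst_conv snd_conv inner_real_def by linarith
  then have "snd y = 0" using assms(2) by simp
  then show ?thesis using assms(1,3) by (simp add: inner_prod_def prod_eq_iff)
qed

text \<open>The second hyperbolic matrix is the conjugate of the first by a lower unipotent one.
  This keeps b and the trace, hence l, and shifts the second coordinate of the eigenvectors by b
  n.\<close>

lemma haagerup_normal_subset_center:
  assumes N: "N \<lhd> Z2_SL2Z" and haag: "haagerup (Z2_SL2Z\<lparr>carrier := N\<rparr>)"
  shows "N \<subseteq> Z2_center"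
proof (rule ccontr)
  assume "\<not> N \<subseteq> Z2_center"
  then obtain v A where vA: "(v, A) \<in> N" "A \<noteq> mat 1" "A \<noteq> - mat 1" by auto
  interpret normal N Z2_SL2Z by fact
  interpret NG: group "Z2_SL2Z\<lparr>carrier := N\<rparr>" by (rule subgroup_imp_group[OF subgroup_axioms])
  obtain k where k: "k \<noteq> 0" "\<And>m n. (vec2 (k * m) (k * n), mat 1) \<in> N"
    using normal_subgroup_lattice[OF N vA(1,2)] by blast
  obtain w a b c d where g: "(w, mat2 a b c d) \<in> N" and det: "a * d - b * c = 1" and tr: "a + d \<ge> 3"
    using normal_subgroup_hyperbolic[OF N vA] by blast
  \<comment> \<open>With b = 0 the diagonal entries would both be 1 or both be -1, against a trace
    of at least 3.\<close>
  have b: "b \<noteq> 0"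
  proof
    assume "b = 0"
    then have "a * d = 1" using det by simp
    then show False using tr by (auto simp: zmult_eq_1_iff)
  qed
  have "real_of_int (a + d) \<ge> 3" using tr by linarith
  then obtain l where l: "l > 1" "l + 1 / l = real_of_int (a + d)" using hyperbolic_eigenvalue by blast
  \<comment> \<open>The second coordinates of the two eigenvectors of one matrix differ by l - 1/l <
    l, so a shift b n with |b n| > l lets no eigenvector of one matrix coincide with one of the
    other.\<close>
  obtain n :: nat where n: "real n > l" using reals_Archimedean2 by blast
  obtain w' where "(w', mat2 1 0 (int n) 1 ** mat2 a b c d ** adj2 (mat2 1 0 (int n) 1)) \<in> N"
    using normal_subgroup_commutator(2)[OF N g, of "mat2 1 0 (int n) 1"] by (auto simp: det_mat2)
  then have g': "(w', mat2 (a - b * int n) b (int n * a + c - (int n * b + d) * int n) (int n * b + d)) \<in> N"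
    by (simp add: mat2_mult algebra_simps)
  let ?a = "a - b * int n" and ?c = "int n * a + c - (int n * b + d) * int n" and ?d = "int n * b + d"
  have det': "?a * ?d - b * ?c = 1" using det by (simp add: algebra_simps)
  have tr': "?a + ?d = a + d" by simp
  \<comment> \<open>The lattice k Z^2 inside N, parametrised by Z^2; the scalar k commutes with
    matrices, so the same integer matrices describe conjugation on it.\<close>
  define \<iota> where "\<iota> z = (vec2 (k * fst z) (k * snd z), mat 1 :: int ^ 2 ^ 2)" for z
  have ev: "is_eigenvector a b c d l (of_int b, l - of_int a)"
    "is_eigenvector a b c d (1 / l) (of_int b, 1 / l - of_int a)"
    "is_eigenvector ?a b ?c ?d l (of_int b, l - of_int ?a)"
    "is_eigenvector ?a b ?c ?d (1 / l) (of_int b, 1 / l - of_int ?a)"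
    using l by (intro eigenvector_formula det det'; simp add: add.commute)+
  have nb: "real n * \<bar>real_of_int b\<bar> > l"
  proof -
    have "\<bar>real_of_int b\<bar> \<ge> 1" using b by linarith
    then have "real n * 1 \<le> real n * \<bar>real_of_int b\<bar>" by (intro mult_left_mono) auto
    then show ?thesis using n by linarith
  qed
  then have nb': "\<bar>real_of_int b * real n\<bar> > l" by (simp add: abs_mult mult.commute)
  have "1 / l > 0" "1 / l < 1" using l(1) by auto
  then have distinct: "real_of_int b * real n \<noteq> 0" "l - 1 / l \<noteq> real_of_int b * real n" "1 / l - l \<noteq> real_of_int b * real n"
    using nb' l(1) by linarith+
  have indep: "((real_of_int b, l - of_int a) \<bullet> y) * ((real_of_int b, 1 / l - of_int a) \<bullet> y) \<noteq> 0 \<or>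
     ((real_of_int b, l - of_int ?a) \<bullet> y) * ((real_of_int b, 1 / l - of_int ?a) \<bullet> y) \<noteq> 0" if "y \<noteq> 0" for y
  proof (rule ccontr)
    assume "\<not> ?thesis"
    then have "\<exists>s\<in>{l - of_int a, 1 / l - of_int a}. \<exists>t\<in>{l - of_int ?a, 1 / l - of_int ?a}.
       (real_of_int b, s) \<bullet> y = 0 \<and> (real_of_int b, t) \<bullet> y = 0" by auto
    then obtain s t where st: "s \<in> {l - of_int a, 1 / l - of_int a}" "t \<in> {l - of_int ?a, 1 / l - of_int ?a}"
      "(real_of_int b, s) \<bullet> y = 0" "(real_of_int b, t) \<bullet> y = 0" by blast
    have "s \<noteq> t" using st(1,2) distinct by auto
    then show False using no_common_zero[OF _ _ st(3,4)] b that by simp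
  qed
  have comm: "(u, mat2 p q r s) \<otimes>\<^bsub>Z2_SL2Z\<lparr>carrier := N\<rparr>\<^esub> \<iota> z
      = \<iota> (lin p q r s z) \<otimes>\<^bsub>Z2_SL2Z\<lparr>carrier := N\<rparr>\<^esub> (u, mat2 p q r s)" for u p q r s z
    by (simp add: \<iota>_def Z2_SL2Z_simps mat2_mult_vec2 lin_def algebra_simps)
  have "\<not> haagerup (Z2_SL2Z\<lparr>carrier := N\<rparr>)"
  proof (rule NG.not_haagerup_if_hyperbolic_pair[where \<iota> = \<iota>, OF _ _ _ _ comm _ comm l(1) ev])
    show "\<iota> z \<in> carrier (Z2_SL2Z\<lparr>carrier := N\<rparr>)" for z using k(2) by (simp add: \<iota>_def)
    show "\<iota> (y + z) = \<iota> y \<otimes>\<^bsub>Z2_SL2Z\<lparr>carrier := N\<rparr>\<^esub> \<iota> z" for y z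
      by (simp add: \<iota>_def Z2_SL2Z_simps vec2_add distrib_left)
    show "inj \<iota>" using k(1) by (auto simp: inj_def \<iota>_def prod_eq_iff)
    show "(w, mat2 a b c d) \<in> carrier (Z2_SL2Z\<lparr>carrier := N\<rparr>)" using g by simp
    show "(w', mat2 ?a b ?c ?d) \<in> carrier (Z2_SL2Z\<lparr>carrier := N\<rparr>)" using g' by simp
  qed (use indep in blast)
  with haag show False by contradiction
qed

theorem proposition2p10:
  shows "is_haagerup_radical (semidirect_product Z2 SL2Z (\<lambda>A v. A *v v))
           (carrier (semidirect_product Z2 (SL2Z\<lparr>carrier := generate SL2Z {- mat 1}\<rparr>) (\<lambda>A v. A *v v)))
         \<and> SL2Z\<lparr>carrier := generate SL2Z {- mat 1}\<rparr> \<cong> integer_mod_group 2"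
proof -
  have "carrier (semidirect_product Z2 (SL2Z\<lparr>carrier := generate SL2Z {- mat 1}\<rparr>) (\<lambda>A v. A *v v)) = Z2_center"
    by (simp add: semidirect_product_def Z2_def generate_neg_mat_1)
  then show ?thesis
    using Z2_center_normal Z2_center_haagerup haagerup_normal_subset_center center_iso
    by (simp add: is_haagerup_radical_def generate_neg_mat_1)
qed

end
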